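(* Let $\Gamma$ be a countable discrete group acting by trace-preserving automorphisms on a finite von Neumann algebra $(M,\tau)$ with separable predual, and let $\mathcal U\subseteq\mathrm{Sub}(M)$ be a URA. Then the index $[\Gamma:\mathrm{Stab}_\Gamma(N)]$ does not depend on $N\in\mathcal U$.
   Context: $\tau$ is a faithful normal tracial state. $\mathrm{Sub}(M)$ is the set of unital von Neumann subalgebras of $M$ with the Effros–Maréchal topology: the smallest topology for which all maps $N\mapsto E_N(x)\in \mathrm{L}^2(M,\tau)$, $x\in M$, are norm continuous, $E_N$ being the $\tau$-preserving conditional expectation onto $N$. Writing $\alpha$ for the action, $\Gamma$ acts on $\mathrm{Sub}(M)$ by $g\cdot N=\alpha_g(N)$, and $\mathrm{Stab}_\Gamma(N)=\{g\in\Gamma:\alpha_g(N)=N\}$. A URA is a minimal (non-empty) closed $\Gamma$-invariant subset of $\mathrm{Sub}(M)$. The index takes values in $\mathbb N\cup\{+\infty\}$. *)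

theory Defs
  imports "HOL-Analysis.Analysis" "HOL-Algebra.Group_Action" "HOL-Library.Extended_Nat"
begin

section \<open>Complex Hilbert spaces and their bounded operators\<close>

text \<open>The libraries have real inner product spaces only. The inner product is linear in the first
  variable; the last axiom also yields positivity and definiteness. Completeness is part of
  \<^class>\<open>banach\<close>.\<close>

class chilbert_space = banach +
  fixes scaleC :: "complex \<Rightarrow> 'a \<Rightarrow> 'a"  (infixr \<open>*\<^sub>C\<close> 75)
    and cinner :: "'a \<Rightarrow> 'a \<Rightarrow> complex"
  assumes scaleC_add_right: "a *\<^sub>C (x + y) = a *\<^sub>C x + a *\<^sub>C y"
    and scaleC_add_left: "(a + b) *\<^sub>C x = a *\<^sub>C x + b *\<^sub>C x"
    and scaleC_scaleC: "a *\<^sub>C b *\<^sub>C x = (a * b) *\<^sub>C x"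
    and scaleC_of_real: "of_real r *\<^sub>C x = scaleR r x"
    and cinner_add_left: "cinner (x + y) z = cinner x z + cinner y z"
    and cinner_scaleC_left: "cinner (a *\<^sub>C x) y = a * cinner x y"
    and cinner_commute: "cinner x y = cnj (cinner y x)"
    and cinner_self: "cinner x x = of_real ((norm x)\<^sup>2)"

lemma norm_scaleC: "norm (c *\<^sub>C (x :: 'h::chilbert_space)) = cmod c * norm x"
proof -
  have "cinner (c *\<^sub>C x) (c *\<^sub>C x) = c * cnj (c * cinner x x)"
    by (metis cinner_commute cinner_scaleC_left)
  also have "\<dots> = of_real ((cmod c * norm x)\<^sup>2)"
    by (simp add: cinner_self complex_norm_square power_mult_distrib flip: mult.assoc of_real_power)
  finally have "(norm (c *\<^sub>C x))\<^sup>2 = (cmod c * norm x)\<^sup>2"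
    unfolding cinner_self of_real_eq_iff .
  then show ?thesis
    by (simp add: power2_eq_iff_nonneg)
qed

text \<open>The type \<open>'h \<Rightarrow>\<^sub>L 'h\<close> consists of the bounded real-linear maps with the operator norm;
  \<open>bounded_ops\<close> is B(H).\<close>

definition bounded_ops :: "('h::chilbert_space \<Rightarrow>\<^sub>L 'h) set"
  where "bounded_ops = {T. \<forall>c x. blinfun_apply T (c *\<^sub>C x) = c *\<^sub>C blinfun_apply T x}"

lift_definition scaleC_op :: "complex \<Rightarrow> ('h::chilbert_space \<Rightarrow>\<^sub>L 'h) \<Rightarrow> ('h \<Rightarrow>\<^sub>L 'h)"
  is "\<lambda>c T x. c *\<^sub>C T x"
proof -
  fix c :: complex and T :: "'h \<Rightarrow> 'h"
  assume T: "bounded_linear T"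
  have "bounded_linear (\<lambda>x::'h. c *\<^sub>C x)"
  proof (rule bounded_linear_intro)
    show "c *\<^sub>C (r *\<^sub>R x) = r *\<^sub>R (c *\<^sub>C x)" for r and x :: 'h
      by (metis mult.commute scaleC_of_real scaleC_scaleC)
    show "norm (c *\<^sub>C x) \<le> norm x * cmod c" for x :: 'h
      by (simp add: norm_scaleC)
  qed (rule scaleC_add_right)
  from bounded_linear_compose[OF this T] show "bounded_linear (\<lambda>x. c *\<^sub>C T x)" .
qed

definition adj :: "('h::chilbert_space \<Rightarrow>\<^sub>L 'h) \<Rightarrow> ('h \<Rightarrow>\<^sub>L 'h)"
  where "adj T = (THE S. \<forall>x y. cinner (blinfun_apply T x) y = cinner x (blinfun_apply S y))"

definition positive_op :: "('h::chilbert_space \<Rightarrow>\<^sub>L 'h) \<Rightarrow> bool"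
  where "positive_op T \<longleftrightarrow> T \<in> bounded_ops \<and> (\<forall>x. cinner (blinfun_apply T x) x \<in> \<real>\<^sub>\<ge>\<^sub>0)"


section \<open>Tracial von Neumann algebras\<close>

definition commutant :: "('h::chilbert_space \<Rightarrow>\<^sub>L 'h) set \<Rightarrow> ('h \<Rightarrow>\<^sub>L 'h) set"
  where "commutant S = {T \<in> bounded_ops. \<forall>s\<in>S. T o\<^sub>L s = s o\<^sub>L T}"

text \<open>Commutants are subalgebras containing the identity of H, so a von Neumann algebra in this sense
  is a unital *-subalgebra of B(H).\<close>

definition von_neumann_algebra :: "('h::chilbert_space \<Rightarrow>\<^sub>L 'h) set \<Rightarrow> bool"
  where "von_neumann_algebra M \<longleftrightarrow> (\<forall>x\<in>M. adj x \<in> M) \<and> commutant (commutant M) = M"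

text \<open>The functionals on M that are restrictions of \<open>x \<mapsto> Tr(x T)\<close>, T trace class; these are the
  \<open>\<sigma>\<close>-weakly continuous ones. They are in particular complex linear.\<close>

definition normal_functional ::
    "('h::chilbert_space \<Rightarrow>\<^sub>L 'h) set \<Rightarrow> (('h \<Rightarrow>\<^sub>L 'h) \<Rightarrow> complex) \<Rightarrow> bool"
  where "normal_functional M \<phi> \<longleftrightarrow>
    (\<exists>\<xi> \<eta> :: nat \<Rightarrow> 'h. summable (\<lambda>n. (norm (\<xi> n))\<^sup>2) \<and> summable (\<lambda>n. (norm (\<eta> n))\<^sup>2) \<and>
       (\<forall>x\<in>M. \<phi> x = (\<Sum>n. cinner (blinfun_apply x (\<xi> n)) (\<eta> n))))"

definition predual ::
    "('h::chilbert_space \<Rightarrow>\<^sub>L 'h) set \<Rightarrow> (('h \<Rightarrow>\<^sub>L 'h) \<Rightarrow> complex) set"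
  where "predual M = {\<phi> \<in> extensional M. normal_functional M \<phi>}"

definition dual_norm ::
    "('h::chilbert_space \<Rightarrow>\<^sub>L 'h) set \<Rightarrow> (('h \<Rightarrow>\<^sub>L 'h) \<Rightarrow> complex) \<Rightarrow> real"
  where "dual_norm M \<phi> = (SUP x\<in>{x \<in> M. norm x \<le> 1}. cmod (\<phi> x))"

definition separable_predual :: "('h::chilbert_space \<Rightarrow>\<^sub>L 'h) set \<Rightarrow> bool"
  where "separable_predual M \<longleftrightarrow>
    (\<exists>D. countable D \<and> D \<subseteq> predual M \<and>
       (\<forall>\<phi>\<in>predual M. \<forall>\<epsilon>>0. \<exists>\<psi>\<in>D. dual_norm M (\<lambda>x. \<phi> x - \<psi> x) < \<epsilon>))"

definition faithful_normal_tracial_state ::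
    "('h::chilbert_space \<Rightarrow>\<^sub>L 'h) set \<Rightarrow> (('h \<Rightarrow>\<^sub>L 'h) \<Rightarrow> complex) \<Rightarrow> bool"
  where "faithful_normal_tracial_state M \<tau> \<longleftrightarrow>
    normal_functional M \<tau> \<and>
    \<tau> id_blinfun = 1 \<and>
    (\<forall>x\<in>M. \<tau> (adj x o\<^sub>L x) \<in> \<real>\<^sub>\<ge>\<^sub>0) \<and>
    (\<forall>x\<in>M. \<tau> (adj x o\<^sub>L x) = 0 \<longrightarrow> x = 0) \<and>
    (\<forall>x\<in>M. \<forall>y\<in>M. \<tau> (x o\<^sub>L y) = \<tau> (y o\<^sub>L x))"

definition tracial_von_neumann_algebra ::
    "('h::chilbert_space \<Rightarrow>\<^sub>L 'h) set \<Rightarrow> (('h \<Rightarrow>\<^sub>L 'h) \<Rightarrow> complex) \<Rightarrow> bool"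
  where "tracial_von_neumann_algebra M \<tau> \<longleftrightarrow>
    von_neumann_algebra M \<and> faithful_normal_tracial_state M \<tau>"

definition norm2 :: "(('h::chilbert_space \<Rightarrow>\<^sub>L 'h) \<Rightarrow> complex) \<Rightarrow> ('h \<Rightarrow>\<^sub>L 'h) \<Rightarrow> real"
  where "norm2 \<tau> x = sqrt (Re (\<tau> (adj x o\<^sub>L x)))"

text \<open>The topology M inherits as a subset of its completion \<open>L\<^sup>2(M,\<tau>)\<close> with respect to
  \<^const>\<open>norm2\<close>. Since \<open>\<tau>\<close> is arbitrary off M, the distance is set to 0 there;
  \<^locale>\<open>Metric_space\<close> asks for nonnegativity and symmetry on the whole type.\<close>

definition L2_topology ::
    "('h::chilbert_space \<Rightarrow>\<^sub>L 'h) set \<Rightarrow> (('h \<Rightarrow>\<^sub>L 'h) \<Rightarrow> complex) \<Rightarrow> ('h \<Rightarrow>\<^sub>L 'h) topology"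
  where "L2_topology M \<tau> =
    Metric_space.mtopology M (\<lambda>x y. if x \<in> M \<and> y \<in> M then norm2 \<tau> (x - y) else 0)"


section \<open>The space of subalgebras\<close>

definition Sub :: "('h::chilbert_space \<Rightarrow>\<^sub>L 'h) set \<Rightarrow> ('h \<Rightarrow>\<^sub>L 'h) set set"
  where "Sub M = {N. N \<subseteq> M \<and> von_neumann_algebra N}"

definition trace_preserving_expectation ::
    "('h::chilbert_space \<Rightarrow>\<^sub>L 'h) set \<Rightarrow> (('h \<Rightarrow>\<^sub>L 'h) \<Rightarrow> complex) \<Rightarrow> ('h \<Rightarrow>\<^sub>L 'h) set
      \<Rightarrow> (('h \<Rightarrow>\<^sub>L 'h) \<Rightarrow> ('h \<Rightarrow>\<^sub>L 'h)) \<Rightarrow> bool"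
  where "trace_preserving_expectation M \<tau> N E \<longleftrightarrow>
    (\<forall>x\<in>M. E x \<in> N) \<and>
    (\<forall>x\<in>M. \<forall>y\<in>M. E (x + y) = E x + E y) \<and>
    (\<forall>c. \<forall>x\<in>M. E (scaleC_op c x) = scaleC_op c (E x)) \<and>
    (\<forall>x\<in>M. positive_op x \<longrightarrow> positive_op (E x)) \<and>
    (\<forall>y\<in>N. E y = y) \<and>
    (\<forall>x\<in>M. \<forall>a\<in>N. \<forall>b\<in>N. E (a o\<^sub>L x o\<^sub>L b) = a o\<^sub>L E x o\<^sub>L b) \<and>
    (\<forall>x\<in>M. \<tau> (E x) = \<tau> x)"

text \<open>The expectation exists and is unique on M for every N in \<^term>\<open>Sub M\<close>; its values outside M
  are irrelevant, whence \<open>SOME\<close> instead of \<open>THE\<close>.\<close>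

definition cond_expectation ::
    "('h::chilbert_space \<Rightarrow>\<^sub>L 'h) set \<Rightarrow> (('h \<Rightarrow>\<^sub>L 'h) \<Rightarrow> complex) \<Rightarrow> ('h \<Rightarrow>\<^sub>L 'h) set
      \<Rightarrow> (('h \<Rightarrow>\<^sub>L 'h) \<Rightarrow> ('h \<Rightarrow>\<^sub>L 'h))"
  where "cond_expectation M \<tau> N = (SOME E. trace_preserving_expectation M \<tau> N E)"

definition effros_marechal_topology ::
    "('h::chilbert_space \<Rightarrow>\<^sub>L 'h) set \<Rightarrow> (('h \<Rightarrow>\<^sub>L 'h) \<Rightarrow> complex) \<Rightarrow> ('h \<Rightarrow>\<^sub>L 'h) set topology"
  where "effros_marechal_topology M \<tau> =
    topology_generated_by
      {{N \<in> Sub M. cond_expectation M \<tau> N x \<in> W} | x W. x \<in> M \<and> openin (L2_topology M \<tau>) W}"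


section \<open>Group actions and uniformly recurrent subalgebras\<close>

definition trace_preserving_automorphism ::
    "('h::chilbert_space \<Rightarrow>\<^sub>L 'h) set \<Rightarrow> (('h \<Rightarrow>\<^sub>L 'h) \<Rightarrow> complex)
      \<Rightarrow> (('h \<Rightarrow>\<^sub>L 'h) \<Rightarrow> ('h \<Rightarrow>\<^sub>L 'h)) \<Rightarrow> bool"
  where "trace_preserving_automorphism M \<tau> f \<longleftrightarrow>
    bij_betw f M M \<and>
    (\<forall>x\<in>M. \<forall>y\<in>M. f (x + y) = f x + f y) \<and>
    (\<forall>c. \<forall>x\<in>M. f (scaleC_op c x) = scaleC_op c (f x)) \<and>
    (\<forall>x\<in>M. \<forall>y\<in>M. f (x o\<^sub>L y) = f x o\<^sub>L f y) \<and>
    (\<forall>x\<in>M. f (adj x) = adj (f x)) \<and>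
    (\<forall>x\<in>M. \<tau> (f x) = \<tau> x)"

definition trace_preserving_action ::
    "('g, 'b) monoid_scheme \<Rightarrow> ('h::chilbert_space \<Rightarrow>\<^sub>L 'h) set \<Rightarrow> (('h \<Rightarrow>\<^sub>L 'h) \<Rightarrow> complex)
      \<Rightarrow> ('g \<Rightarrow> ('h \<Rightarrow>\<^sub>L 'h) \<Rightarrow> ('h \<Rightarrow>\<^sub>L 'h)) \<Rightarrow> bool"
  where "trace_preserving_action G M \<tau> \<alpha> \<longleftrightarrow>
    group_action G M \<alpha> \<and> (\<forall>g\<in>carrier G. trace_preserving_automorphism M \<tau> (\<alpha> g))"

definition invariant_subset ::
    "('g, 'b) monoid_scheme \<Rightarrow> ('g \<Rightarrow> 'x \<Rightarrow> 'x) \<Rightarrow> 'x set \<Rightarrow> bool"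
  where "invariant_subset G \<beta> V \<longleftrightarrow> (\<forall>g\<in>carrier G. \<forall>N\<in>V. \<beta> g N \<in> V)"

abbreviation sub_action :: "('g \<Rightarrow> 'x \<Rightarrow> 'x) \<Rightarrow> 'g \<Rightarrow> 'x set \<Rightarrow> 'x set"
  where "sub_action \<alpha> \<equiv> (\<lambda>g N. \<alpha> g ` N)"

definition URA ::
    "('g, 'b) monoid_scheme \<Rightarrow> ('h::chilbert_space \<Rightarrow>\<^sub>L 'h) set \<Rightarrow> (('h \<Rightarrow>\<^sub>L 'h) \<Rightarrow> complex)
      \<Rightarrow> ('g \<Rightarrow> ('h \<Rightarrow>\<^sub>L 'h) \<Rightarrow> ('h \<Rightarrow>\<^sub>L 'h)) \<Rightarrow> ('h \<Rightarrow>\<^sub>L 'h) set set \<Rightarrow> bool"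
  where "URA G M \<tau> \<alpha> \<U> \<longleftrightarrow>
    \<U> \<subseteq> Sub M \<and> \<U> \<noteq> {} \<and>
    closedin (effros_marechal_topology M \<tau>) \<U> \<and> invariant_subset G (sub_action \<alpha>) \<U> \<and>
    (\<forall>V. V \<subseteq> \<U> \<and> V \<noteq> {} \<and> closedin (effros_marechal_topology M \<tau>) V \<and>
         invariant_subset G (sub_action \<alpha>) V \<longrightarrow> V = \<U>)"

definition subgroup_index :: "('g, 'b) monoid_scheme \<Rightarrow> 'g set \<Rightarrow> enat"
  where "subgroup_index G H =
    (if finite (rcosets\<^bsub>G\<^esub> H) then enat (card (rcosets\<^bsub>G\<^esub> H)) else \<infinity>)"

end

theory Submission
  imports Defs
begin

text \<open>By the orbit-stabilizer bijection the index of \<open>Stab(N)\<close> is the number of elements of the orbit of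
  \<open>N\<close>, or \<open>\<infinity>\<close>. If some orbit \<open>O\<close> in \<open>\<U>\<close> is finite and points of \<open>Sub(M)\<close> are closed, then \<open>O\<close> is a
  closed invariant subset, so \<open>O = \<U>\<close> by minimality, and every orbit equals \<open>\<U>\<close>. Otherwise all orbits
  are infinite. This is \<open>minimal_invariant_index_constant\<close>.

  Points are closed because \<open>N\<close> is the set of fixed points in \<open>M\<close> of \<open>E\<^sub>N\<close>, so that different
  subalgebras are told apart by some \<open>E\<^sub>N(x)\<close>, an element of the Hausdorff space \<open>L\<^sup>2(M,\<tau>)\<close>
  (\<open>closedin_effros_marechal_singleton\<close>). This presupposes that a trace-preserving conditional
  expectation onto \<open>N\<close> exists, and most of the development constructs it.

  Given a strict contraction \<open>x \<in> M\<close>, let \<open>y\<close> be a point of the unit ball of \<open>N\<close> at minimal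
  \<open>\<parallel>\<cdot>\<parallel>\<^sub>2\<close>-distance from \<open>x\<close>; it exists because the ball is weakly compact and \<open>\<tau>\<close> is normal
  (\<open>nearest_point\<close>). If \<open>y\<close> were an interior point, varying it in all directions would show
  \<open>x - y \<bottom> N\<close>. In general the directions \<open>(1 - yy\<^sup>*) a (1 - y\<^sup>*y)\<close> with \<open>a \<in> N\<close>
  are still admissible, which gives orthogonality to these elements
  (\<open>norm_defect_perturbation_le\<close>). Shrinking \<open>y\<close> to \<open>y (1 - t (y\<^sup>*y)\<^sup>2\<^sup>m)\<close> is also possible, and because
  \<open>\<parallel>x\<parallel> \<le> c < 1\<close> it forces \<open>\<parallel>(y\<^sup>*y)\<^sup>m\<parallel>\<^sub>2 \<le> c\<^sup>m\<close> (\<open>nearest_point_power_decay\<close>). Since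
  \<open>1 - (y\<^sup>*y)\<^sup>m\<close> is a multiple of \<open>1 - y\<^sup>*y\<close>, every \<open>a \<in> N\<close> is a \<open>\<parallel>\<cdot>\<parallel>\<^sub>2\<close>-limit of elements
  \<open>(1 - yy\<^sup>*) b (1 - y\<^sup>*y)\<close>, whence \<open>x - y \<bottom> N\<close> after all (\<open>nearest_point_orthogonal\<close>).

  The element \<open>E x \<in> N\<close> with \<open>\<tau>(a E x) = \<tau>(a x)\<close> for all \<open>a \<in> N\<close> is unique, so linearity, the bimodule
  property and invariance of the trace are formal. The construction also gives \<open>\<parallel>E x\<parallel> \<le> \<parallel>x\<parallel>\<close>, and
  positivity follows as for every unital contraction (\<open>E_positive\<close>).\<close>

section \<open>Hilbert space\<close>

lemma cinner_add_right: "cinner x (y + z) = cinner x y + cinner (x :: 'h::chilbert_space) z"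
  by (metis cinner_add_left cinner_commute complex_cnj_add)

lemma cinner_scaleC_right: "cinner x (a *\<^sub>C y) = cnj a * cinner (x :: 'h::chilbert_space) y"
  by (metis cinner_commute cinner_scaleC_left complex_cnj_mult)

lemma scaleC_minus_one: "(-1) *\<^sub>C x = - (x :: 'h::chilbert_space)"
  using scaleC_of_real[of "-1" x] by simp

lemma scaleC_one [simp]: "1 *\<^sub>C x = (x :: 'h::chilbert_space)"
  using scaleC_of_real[of 1 x] by simp

lemma cinner_minus_left: "cinner (- x) y = - cinner (x :: 'h::chilbert_space) y"
  using cinner_scaleC_left[of "-1" x y] by (simp add: scaleC_minus_one)

lemma cinner_minus_right: "cinner x (- y) = - cinner (x :: 'h::chilbert_space) y"
  using cinner_scaleC_right[of x "-1" y] by (simp add: scaleC_minus_one)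

lemma cinner_diff_left: "cinner (x - y) z = cinner x z - cinner (y :: 'h::chilbert_space) z"
  using cinner_add_left[of x "-y" z] by (simp add: cinner_minus_left)

lemma cinner_diff_right: "cinner x (y - z) = cinner x y - cinner (x :: 'h::chilbert_space) z"
  using cinner_add_right[of x y "-z"] by (simp add: cinner_minus_right)

lemma cinner_scaleR_left: "cinner (r *\<^sub>R x) y = of_real r * cinner (x :: 'h::chilbert_space) y"
  by (metis cinner_scaleC_left scaleC_of_real)

lemma cinner_scaleR_right: "cinner x (r *\<^sub>R y) = of_real r * cinner (x :: 'h::chilbert_space) y"
  using cinner_scaleC_right[of x "of_real r" y] by (simp add: scaleC_of_real)

lemmas cinner_simps =
  cinner_add_left cinner_add_right cinner_diff_left cinner_diff_right
  cinner_minus_left cinner_minus_right cinner_scaleC_left cinner_scaleC_right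
  cinner_scaleR_left cinner_scaleR_right

lemma Re_cinner_commute: "Re (cinner x y) = Re (cinner y (x :: 'h::chilbert_space))"
  by (subst cinner_commute) simp

lemma norm_add_square:
  "(norm (x + y))\<^sup>2 = (norm x)\<^sup>2 + 2 * Re (cinner x y) + (norm (y :: 'h::chilbert_space))\<^sup>2"
proof -
  have "(norm (x + y))\<^sup>2 = Re (cinner (x + y) (x + y))"
    by (simp only: cinner_self Re_complex_of_real)
  also have "\<dots> = Re (cinner x x) + Re (cinner x y) + (Re (cinner y x) + Re (cinner y y))"
    by (simp only: cinner_simps plus_complex.sel)
  finally show ?thesis
    using Re_cinner_commute[of x y] by (simp add: cinner_self)
qed

lemma norm_diff_square:
  "(norm (x - y))\<^sup>2 = (norm x)\<^sup>2 - 2 * Re (cinner x y) + (norm (y :: 'h::chilbert_space))\<^sup>2"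
  using norm_add_square[of x "-y"] by (simp add: cinner_minus_right)

text \<open>The discriminant condition, in the form that yields the Cauchy-Schwarz inequality for a form
  that may be degenerate.\<close>

lemma real_quadratic_nonneg_imp:
  fixes a b c :: real
  assumes "\<And>t. 0 \<le> a + 2 * t * b + t\<^sup>2 * c" and "0 \<le> a" and "0 \<le> c"
  shows "b \<le> sqrt a * sqrt c"
proof -
  have "b\<^sup>2 \<le> a * c"
  proof (cases "c = 0")
    case True
    show ?thesis
    proof (cases "b = 0")
      case False
      \<comment> \<open>a linear polynomial; at this \<open>t\<close> it takes the value \<open>-1\<close>\<close>
      with assms(1)[of "- (a + 1) / (2 * b)"] True have "0 \<le> a + (- (2 * a) - 2) / 2"
        by simp
      then have False by (simp add: field_simps)
      then show ?thesis ..
    qed (simp add: True)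
  next
    case False
    with \<open>0 \<le> c\<close> have "0 < c" by simp
    have "0 \<le> a + 2 * (- b / c) * b + (- b / c)\<^sup>2 * c" by (rule assms(1))
    also have "\<dots> = a - b\<^sup>2 / c"
      using \<open>0 < c\<close> by (simp add: power2_eq_square field_simps)
    finally show ?thesis
      using \<open>0 < c\<close> by (simp add: field_simps)
  qed
  then have "b \<le> sqrt (a * c)" by (simp add: real_le_rsqrt)
  then show ?thesis by (simp add: real_sqrt_mult)
qed

lemma Re_cinner_le: "Re (cinner x y) \<le> norm x * norm (y :: 'h::chilbert_space)"
proof -
  have "0 \<le> (norm x)\<^sup>2 + 2 * t * Re (cinner x y) + t\<^sup>2 * (norm y)\<^sup>2" for t
    using norm_add_square[of x "t *\<^sub>R y"] zero_le_power2[of "norm (x + t *\<^sub>R y)"]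
    by (simp add: cinner_scaleR_right power_mult_distrib algebra_simps)
  from real_quadratic_nonneg_imp[OF this] show ?thesis by simp
qed

lemma phase_times: obtains c where "cmod c = 1" and "c * z = of_real (cmod z)"
proof (cases "z = 0")
  case True
  then show ?thesis by (intro that[of 1]) auto
next
  case False
  have "cnj z / cmod z * z = of_real (cmod z)"
  proof -
    have "cnj z * z = of_real (cmod z) * of_real (cmod z)"
      using complex_norm_square[of z] by (simp add: power2_eq_square mult.commute)
    then have "cnj z / cmod z * z = of_real (cmod z) * of_real (cmod z) / of_real (cmod z)"
      by simp
    with False show ?thesis by simp
  qed
  with False show ?thesis by (intro that[of "cnj z / cmod z"]) (auto simp: norm_divide)
qed

lemma cmod_cinner_le: "cmod (cinner x y) \<le> norm x * norm (y :: 'h::chilbert_space)"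
proof -
  obtain c where c: "cmod c = 1" "c * cinner x y = of_real (cmod (cinner x y))"
    by (rule phase_times)
  have "cmod (cinner x y) = Re (cinner (c *\<^sub>C x) y)"
    by (simp add: cinner_scaleC_left c)
  also have "\<dots> \<le> norm (c *\<^sub>C x) * norm y" by (rule Re_cinner_le)
  finally show ?thesis by (simp add: norm_scaleC c)
qed

lemma cinner_ext_left:
  assumes "\<And>z. cinner x z = cinner (y :: 'h::chilbert_space) z" shows "x = y"
proof -
  have "cinner (x - y) (x - y) = 0" by (simp add: cinner_diff_left assms)
  then show ?thesis by (simp add: cinner_self)
qed

lemma cinner_ext_right:
  assumes "\<And>z. cinner z x = cinner z (y :: 'h::chilbert_space)" shows "x = y"
  by (rule cinner_ext_left) (metis assms cinner_commute)

text \<open>Reduces complex identities to real parts, in which variational inequalities come.\<close>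

lemma complex_eqI_Re:
  assumes "\<And>c. Re (c * z) = Re (c * w)" shows "z = w"
  using assms[of 1] assms[of "\<i>"] by (simp add: complex_eq_iff)

text \<open>The representing vector minimises the strictly convex functional
  \<open>x \<mapsto> \<parallel>x\<parallel>\<^sup>2 - 2 Re (f x)\<close>; the parallelogram law makes every minimising sequence Cauchy.\<close>

lemma riesz_representation:
  fixes f :: "'h::chilbert_space \<Rightarrow> complex"
  assumes add: "\<And>x y. f (x + y) = f x + f y"
    and scale: "\<And>c x. f (c *\<^sub>C x) = c * f x"
    and bound: "\<And>x. cmod (f x) \<le> K * norm x"
  shows "\<exists>v. \<forall>x. f x = cinner x v"
proof -
  define J where "J x = (norm x)\<^sup>2 - 2 * Re (f x)" for x
  have J_add: "J (x + z) = J x + 2 * (Re (cinner z x) - Re (f z)) + (norm z)\<^sup>2" for x z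
    using Re_cinner_commute[of x z] by (simp add: J_def norm_add_square add)
  have J_ge: "- K\<^sup>2 \<le> J x" for x
  proof -
    have "Re (f x) \<le> K * norm x"
      by (rule order.trans[OF complex_Re_le_cmod bound])
    moreover have "0 \<le> (norm x - K)\<^sup>2" by simp
    ultimately show ?thesis by (simp add: J_def power2_diff mult.commute)
  qed
  define d where "d = Inf (range J)"
  have bdd: "bdd_below (range J)" using J_ge by (rule bdd_belowI2)
  have d_le: "d \<le> J x" for x unfolding d_def by (rule cInf_lower[OF _ bdd]) simp
  have "\<exists>x. J x < d + inverse (real (Suc n))" for n
    using cInf_lessD[of "range J" "d + inverse (real (Suc n))"] by (force simp: d_def)
  then obtain x where x: "\<And>n. J (x n) < d + inverse (real (Suc n))" by metis
  have J_half: "(norm (y - z))\<^sup>2 \<le> 2 * J y + 2 * J z - 4 * d" for y z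
  proof -
    have "J ((1/2) *\<^sub>R (y + z)) = (1/4) * (norm (y + z))\<^sup>2 - (Re (f y) + Re (f z))"
      using scale[of "of_real (1/2)" "y + z"]
      by (simp add: J_def add scaleC_of_real power_mult_distrib power2_eq_square
           del: of_real_divide) (simp add: field_simps)
    also have "\<dots> = (1/4) * ((norm y)\<^sup>2 + 2 * Re (cinner y z) + (norm z)\<^sup>2)
        - (Re (f y) + Re (f z))"
      by (simp only: norm_add_square)
    finally have J_mid: "J ((1/2) *\<^sub>R (y + z))
        = (1/4) * ((norm y)\<^sup>2 + 2 * Re (cinner y z) + (norm z)\<^sup>2) - (Re (f y) + Re (f z))" .
    have "d \<le> (1/4) * ((norm y)\<^sup>2 + 2 * Re (cinner y z) + (norm z)\<^sup>2) - (Re (f y) + Re (f z))"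
      using d_le[of "(1/2) *\<^sub>R (y + z)"] by (simp only: J_mid)
    then show ?thesis unfolding J_def norm_diff_square by argo
  qed
  have "Cauchy x"
  proof (rule metric_CauchyI)
    fix e :: real assume "0 < e"
    obtain N where N: "inverse (real (Suc N)) < e\<^sup>2 / 4"
      using reals_Archimedean[of "e\<^sup>2 / 4"] \<open>0 < e\<close> by auto
    have small: "J (x n) < d + e\<^sup>2 / 4" if "n \<ge> N" for n
    proof -
      have "inverse (real (Suc n)) \<le> inverse (real (Suc N))" using that by simp
      with x[of n] N show ?thesis by linarith
    qed
    show "\<exists>N. \<forall>m\<ge>N. \<forall>n\<ge>N. dist (x m) (x n) < e"
    proof (intro exI allI impI)
      fix m n assume "N \<le> m" "N \<le> n"
      have "2 * J (x m) + 2 * J (x n) - 4 * d < e\<^sup>2"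
        using small[OF \<open>N \<le> m\<close>] small[OF \<open>N \<le> n\<close>] by linarith
      with J_half[of "x m" "x n"] have "(norm (x m - x n))\<^sup>2 < e\<^sup>2" by (rule order.strict_trans1)
      then show "dist (x m) (x n) < e"
        using \<open>0 < e\<close> by (simp add: dist_norm power_less_imp_less_base)
    qed
  qed
  then obtain v where v: "x \<longlonglongrightarrow> v" using Cauchy_convergent convergent_def by blast
  have "f y - f z = f (y - z)" for y z using add[of "y - z" z] by simp
  then have "norm (f (x n) - f v) \<le> K * norm (x n - v)" for n by (simp add: bound)
  then have "eventually (\<lambda>n. norm (f (x n) - f v) \<le> K * norm (x n - v)) sequentially"
    by simp
  moreover have "(\<lambda>n. K * norm (x n - v)) \<longlonglongrightarrow> 0"
    using tendsto_mult_right_zero[OF tendsto_norm_zero[OF LIM_zero[OF v]]] .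
  ultimately have fx: "(\<lambda>n. f (x n)) \<longlonglongrightarrow> f v"
    by (rule LIM_zero_cancel[OF Lim_null_comparison])
  have "(\<lambda>n. J (x n)) \<longlonglongrightarrow> J v" unfolding J_def by (intro tendsto_intros v fx)
  moreover have "(\<lambda>n. d + inverse (real (Suc n))) \<longlonglongrightarrow> d + 0"
    by (intro tendsto_intros LIMSEQ_inverse_real_of_nat)
  ultimately have Jv: "J v \<le> d" using x by (intro LIMSEQ_le) (auto intro: less_imp_le)
  have re_le: "Re (f z) - Re (cinner z v) \<le> 0" for z
  proof -
    have up: "0 \<le> 0 + 2 * t * (Re (cinner z v) - Re (f z)) + t\<^sup>2 * (norm z)\<^sup>2" for t
    proof -
      have "J v \<le> J (v + t *\<^sub>R z)" by (rule order.trans[OF Jv d_le])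
      then show ?thesis
        using scale[of "of_real t" z]
        by (simp add: J_add scaleC_of_real cinner_scaleR_left power_mult_distrib algebra_simps)
    qed
    have "0 \<le> 0 + 2 * t * (Re (f z) - Re (cinner z v)) + t\<^sup>2 * (norm z)\<^sup>2" for t
      using up[of "-t"] by (simp add: algebra_simps)
    from real_quadratic_nonneg_imp[OF this] show ?thesis by simp
  qed
  have "f z = cinner z v" for z
  proof (rule complex_eqI_Re)
    fix c
    have "Re (c * f z) \<le> Re (c * cinner z v)" for c
      using re_le[of "c *\<^sub>C z"] by (simp only: scale cinner_scaleC_left)
    from this[of c] this[of "-c"] show "Re (c * f z) = Re (c * cinner z v)" by simp
  qed
  then show ?thesis by blast
qed

text \<open>Representing \<open>B(\<cdot>, y)\<close> by a vector for each \<open>y\<close>, the vector depends linearly on \<open>y\<close> by uniqueness.\<close>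

lemma sesquilinear_representation:
  fixes B :: "'h::chilbert_space \<Rightarrow> 'h \<Rightarrow> complex"
  assumes addl: "\<And>x x' y. B (x + x') y = B x y + B x' y"
    and scl: "\<And>c x y. B (c *\<^sub>C x) y = c * B x y"
    and addr: "\<And>x y y'. B x (y + y') = B x y + B x y'"
    and scr: "\<And>c x y. B x (c *\<^sub>C y) = cnj c * B x y"
    and bound: "\<And>x y. cmod (B x y) \<le> K * norm x * norm y"
    and K: "0 \<le> K"
  shows "\<exists>S\<in>bounded_ops. norm S \<le> K \<and> (\<forall>x y. B x y = cinner x (blinfun_apply S y))"
proof -
  have "\<exists>v. \<forall>x. B x y = cinner x v" for y
    using bound[of _ y] by (intro riesz_representation[where K = "K * norm y"]) (auto simp: addl scl ac_simps)
  then obtain s where s: "\<And>x y. B x y = cinner x (s y)" by metis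
  have s_add: "s (y + y') = s y + s y'" for y y'
    by (rule cinner_ext_right) (simp add: cinner_add_right addr flip: s)
  have s_sc: "s (c *\<^sub>C y) = c *\<^sub>C s y" for c y
    by (rule cinner_ext_right) (simp add: cinner_scaleC_right scr flip: s)
  have s_norm: "norm (s y) \<le> norm y * K" for y
  proof (cases "s y = 0")
    case False
    have "norm (s y) * norm (s y) = cmod (B (s y) y)"
      by (simp add: s cinner_self power2_eq_square norm_mult)
    also have "\<dots> \<le> norm (s y) * (norm y * K)" using bound[of "s y" y] by (simp add: ac_simps)
    finally show ?thesis using False by simp
  qed (simp add: K)
  have "bounded_linear s"
    using s_sc[of "of_real _"] by (intro bounded_linear_intro[where K = K]) (auto simp: s_add s_norm scaleC_of_real)
  then have app: "blinfun_apply (Blinfun s) = s" by (rule bounded_linear_Blinfun_apply)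
  show ?thesis
    using s_norm by (intro bexI[of _ "Blinfun s"]) (auto simp: app s bounded_ops_def s_sc K mult.commute intro!: norm_blinfun_bound)
qed

section \<open>Adjoints\<close>

lemma cinner_adj:
  fixes T :: "'h::chilbert_space \<Rightarrow>\<^sub>L 'h"
  assumes T: "T \<in> bounded_ops"
  shows cinner_adj_right: "cinner (blinfun_apply T x) y = cinner x (blinfun_apply (adj T) y)"
    and adj_bounded_ops: "adj T \<in> bounded_ops"
    and norm_adj_le: "norm (adj T) \<le> norm T"
proof -
  have "\<exists>S\<in>bounded_ops. norm S \<le> norm T \<and>
      (\<forall>x y. cinner (blinfun_apply T x) y = cinner x (blinfun_apply S y))"
  proof (rule sesquilinear_representation)
    show "cmod (cinner (blinfun_apply T x) y) \<le> norm T * norm x * norm y" for x y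
      by (meson cmod_cinner_le mult_right_mono norm_blinfun norm_ge_zero order.trans)
  qed (use T in \<open>simp_all add: blinfun.add_right cinner_simps bounded_ops_def\<close>)
  then obtain S where S: "S \<in> bounded_ops" "norm S \<le> norm T"
      "\<forall>x y. cinner (blinfun_apply T x) y = cinner x (blinfun_apply S y)" by blast
  have "adj T = S"
    unfolding adj_def
  proof (rule the_equality)
    fix S' assume S': "\<forall>x y. cinner (blinfun_apply T x) y = cinner x (blinfun_apply S' y)"
    show "S' = S"
      by (intro blinfun_eqI cinner_ext_right) (metis S(3) S')
  qed (rule S(3))
  with S show "cinner (blinfun_apply T x) y = cinner x (blinfun_apply (adj T) y)"
    and "adj T \<in> bounded_ops" and "norm (adj T) \<le> norm T" by auto
qed

lemma cinner_adj_left: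
  "T \<in> bounded_ops \<Longrightarrow> cinner (blinfun_apply (adj T) x) y = cinner x (blinfun_apply T y)"
  by (metis cinner_adj_right cinner_commute)

lemma adj_eqI:
  assumes "T \<in> bounded_ops"
    and "\<And>x y. cinner (blinfun_apply T x) y = cinner x (blinfun_apply S y)"
  shows "adj T = S"
  by (intro blinfun_eqI cinner_ext_right) (metis assms cinner_adj_right)

lemma bounded_opsD: "T \<in> bounded_ops \<Longrightarrow> blinfun_apply T (c *\<^sub>C x) = c *\<^sub>C blinfun_apply T x"
  by (simp add: bounded_ops_def)

lemma scaleC_op_apply [simp]: "blinfun_apply (scaleC_op c T) x = c *\<^sub>C blinfun_apply T x"
  by (simp add: scaleC_op.rep_eq)

lemma scaleC_op_of_real: "scaleC_op (of_real r) T = r *\<^sub>R T"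
  by (rule blinfun_eqI) (simp add: scaleC_of_real blinfun.scaleR_left)

section \<open>Self-adjoint operator algebras\<close>

text \<open>The algebra axioms that \<open>M\<close> inherits from being a self-adjoint bicommutant.\<close>

locale star_algebra =
  fixes M :: "('h::chilbert_space \<Rightarrow>\<^sub>L 'h) set"
  assumes bounded: "x \<in> M \<Longrightarrow> x \<in> bounded_ops"
    and add_mem: "x \<in> M \<Longrightarrow> y \<in> M \<Longrightarrow> x + y \<in> M"
    and mult_mem: "x \<in> M \<Longrightarrow> y \<in> M \<Longrightarrow> x o\<^sub>L y \<in> M"
    and scale_mem: "x \<in> M \<Longrightarrow> scaleC_op c x \<in> M"
    and id_mem: "id_blinfun \<in> M"
    and adj_mem: "x \<in> M \<Longrightarrow> adj x \<in> M"
begin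

lemma scaleR_mem: "x \<in> M \<Longrightarrow> r *\<^sub>R x \<in> M"
  using scale_mem[of x "of_real r"] by (simp add: scaleC_op_of_real)

lemma uminus_mem: "x \<in> M \<Longrightarrow> - x \<in> M"
  using scaleR_mem[of x "-1"] by simp

lemma diff_mem: "x \<in> M \<Longrightarrow> y \<in> M \<Longrightarrow> x - y \<in> M"
  using add_mem[of x "-y"] uminus_mem[of y] by simp

lemma zero_mem: "0 \<in> M"
  using scaleR_mem[OF id_mem, of 0] by simp

lemma adj_adj: "x \<in> M \<Longrightarrow> adj (adj x) = x"
  by (intro adj_eqI adj_bounded_ops bounded) (simp_all add: cinner_adj_left bounded)

lemma adj_mult: "x \<in> M \<Longrightarrow> y \<in> M \<Longrightarrow> adj (x o\<^sub>L y) = adj y o\<^sub>L adj x"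
  by (intro adj_eqI) (simp_all add: cinner_adj_right bounded mult_mem)

lemma adj_add: "x \<in> M \<Longrightarrow> y \<in> M \<Longrightarrow> adj (x + y) = adj x + adj y"
  by (intro adj_eqI) (simp_all add: cinner_adj_right bounded add_mem blinfun.add_left cinner_simps)

lemma adj_diff: "x \<in> M \<Longrightarrow> y \<in> M \<Longrightarrow> adj (x - y) = adj x - adj y"
  by (intro adj_eqI) (simp_all add: cinner_adj_right bounded diff_mem blinfun.diff_left cinner_simps)

lemma adj_scale: "x \<in> M \<Longrightarrow> adj (scaleC_op c x) = scaleC_op (cnj c) (adj x)"
  by (intro adj_eqI) (simp_all add: cinner_adj_right bounded scale_mem cinner_simps)

lemma adj_scaleR: "x \<in> M \<Longrightarrow> adj (r *\<^sub>R x) = r *\<^sub>R adj x"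
  using adj_scale[of x "of_real r"] by (simp add: scaleC_op_of_real)

lemma adj_id: "adj id_blinfun = (id_blinfun :: 'h \<Rightarrow>\<^sub>L 'h)"
  by (intro adj_eqI) (auto simp: bounded id_mem)

lemma norm_adj: "x \<in> M \<Longrightarrow> norm (adj x) = norm x"
  by (metis adj_adj adj_mem antisym bounded norm_adj_le)

end

lemma bounded_ops_closed:
  fixes x y :: "'h::chilbert_space \<Rightarrow>\<^sub>L 'h"
  assumes "x \<in> bounded_ops" "y \<in> bounded_ops"
  shows "x + y \<in> bounded_ops" "x o\<^sub>L y \<in> bounded_ops" "scaleC_op c x \<in> bounded_ops"
  using assms by (simp_all add: bounded_ops_def blinfun.add_left scaleC_add_right scaleC_scaleC mult.commute)

lemma commutant_iff:
  "T \<in> commutant S \<longleftrightarrow> T \<in> bounded_ops \<and>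
    (\<forall>s\<in>S. \<forall>\<xi>. blinfun_apply T (blinfun_apply s \<xi>) = blinfun_apply s (blinfun_apply T \<xi>))"
proof -
  have "T o\<^sub>L s = s o\<^sub>L T \<longleftrightarrow>
      (\<forall>\<xi>. blinfun_apply T (blinfun_apply s \<xi>) = blinfun_apply s (blinfun_apply T \<xi>))" for s
    by (metis blinfun_apply_blinfun_compose blinfun_eqI)
  then show ?thesis by (simp add: commutant_def)
qed

lemma von_neumann_algebra_star_algebra:
  assumes "von_neumann_algebra M" shows "star_algebra M"
proof -
  define S where "S = commutant M"
  have M: "M = commutant S" and adj: "\<And>x. x \<in> M \<Longrightarrow> adj x \<in> M"
    using assms by (auto simp: von_neumann_algebra_def S_def)
  have S: "s \<in> bounded_ops" if "s \<in> S" for s using that by (simp add: S_def commutant_def)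
  show ?thesis
  proof
    fix x y :: "'a \<Rightarrow>\<^sub>L 'a" and c
    show "x \<in> bounded_ops" if "x \<in> M" using that by (simp add: M commutant_def)
    show "x + y \<in> M" "x o\<^sub>L y \<in> M" if "x \<in> M" "y \<in> M"
      using that by (auto simp: M commutant_iff bounded_ops_closed blinfun.add_left blinfun.add_right)
    show "scaleC_op c x \<in> M" if "x \<in> M"
      using that S by (auto simp: M commutant_iff bounded_ops_closed bounded_opsD)
    show "id_blinfun \<in> M" by (auto simp: M commutant_iff bounded_ops_def)
    show "adj x \<in> M" if "x \<in> M" using that by (rule adj)
  qed
qed

section \<open>Weak limits of operators\<close>

text \<open>Weak compactness of the unit ball of \<open>B(H)\<close>: the matrix coefficients
  \<open>(\<xi>, \<eta>) \<mapsto> \<langle>y\<^sub>n \<xi>, \<eta>\<rangle>\<close> lie in a product of discs, which is compact by Tychonoff. As \<open>H\<close> may be nonseparable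
  there need not be a convergent subsequence, so the limit is taken along a filter finer than
  \<open>sequentially\<close>.\<close>

lemma weak_cluster_point:
  fixes y :: "nat \<Rightarrow> 'h::chilbert_space \<Rightarrow>\<^sub>L 'h"
  assumes y: "\<And>n. y n \<in> bounded_ops" and norm_y: "\<And>n. norm (y n) \<le> 1"
  obtains F T where "F \<noteq> bot" "F \<le> sequentially" "T \<in> bounded_ops" "norm T \<le> 1"
    "\<And>\<xi> \<eta>. ((\<lambda>n. cinner (blinfun_apply (y n) \<xi>) \<eta>) \<longlongrightarrow> cinner (blinfun_apply T \<xi>) \<eta>) F"
proof -
  define g where "g n = (\<lambda>p :: 'h \<times> 'h. cinner (blinfun_apply (y n) (fst p)) (snd p))" for n
  define K where "K = PiE UNIV (\<lambda>p :: 'h \<times> 'h. cball (0::complex) (norm (fst p) * norm (snd p)))"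
  have g_bound: "cmod (g n p) \<le> norm (fst p) * norm (snd p)" for n p
  proof -
    have "cmod (g n p) \<le> norm (blinfun_apply (y n) (fst p)) * norm (snd p)"
      unfolding g_def by (rule cmod_cinner_le)
    also have "norm (blinfun_apply (y n) (fst p)) \<le> 1 * norm (fst p)"
      by (rule order.trans[OF norm_blinfun mult_right_mono[OF norm_y]]) simp
    finally show ?thesis by (simp add: mult_right_mono)
  qed
  have "compactin (product_topology (\<lambda>_. euclidean) UNIV) K"
    unfolding K_def by (subst compactin_PiE) simp
  then have "compact K" by (simp add: euclidean_product_topology)
  moreover have "filtermap g sequentially \<noteq> bot" by (simp add: filtermap_bot_iff)
  moreover have "eventually (\<lambda>x. x \<in> K) (filtermap g sequentially)"
    using g_bound by (auto simp: eventually_filtermap K_def PiE_iff intro!: always_eventually)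
  ultimately obtain f where f: "f \<in> K" "inf (nhds f) (filtermap g sequentially) \<noteq> bot"
    unfolding compact_filter by blast
  define F where "F = inf (filtercomap g (nhds f)) sequentially"
  \<comment> \<open>\<open>f\<close> is a cluster point, so its neighbourhoods meet all tails of \<open>g\<close>\<close>
  have F: "F \<noteq> bot"
  proof
    assume "F = bot"
    then have "eventually (\<lambda>_. False) F" by simp
    then obtain P Q where P: "eventually P (nhds f)" and Q: "eventually Q sequentially"
      and PQ: "\<And>n. P (g n) \<Longrightarrow> Q n \<Longrightarrow> False"
      unfolding F_def eventually_inf eventually_filtercomap by blast
    have "eventually (\<lambda>p. \<exists>n. p = g n \<and> Q n) (filtermap g sequentially)"
      unfolding eventually_filtermap by (rule eventually_mono[OF Q]) blast
    with P have "eventually (\<lambda>_. False) (inf (nhds f) (filtermap g sequentially))"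
      unfolding eventually_inf using PQ by blast
    with f(2) show False by (simp add: eventually_False)
  qed
  have g_lim: "filterlim g (nhds f) F"
    unfolding filterlim_iff_le_filtercomap F_def by simp
  have lim: "((\<lambda>n. g n p) \<longlongrightarrow> f p) F" for p
  proof (rule topological_tendstoI)
    fix S assume S: "open S" "f p \<in> S"
    have "open ((\<lambda>h :: 'h \<times> 'h \<Rightarrow> complex. h p) -` S)"
      by (rule open_vimage[OF S(1)]) simp
    from topological_tendstoD[OF g_lim this] S(2)
    show "eventually (\<lambda>n. g n p \<in> S) F" by simp
  qed
  define B where "B \<xi> \<eta> = f (\<xi>, \<eta>)" for \<xi> \<eta>
  have B: "((\<lambda>n. cinner (blinfun_apply (y n) \<xi>) \<eta>) \<longlongrightarrow> B \<xi> \<eta>) F" for \<xi> \<eta>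
    using lim[of "(\<xi>, \<eta>)"] by (simp add: B_def g_def)
  note uniq = tendsto_unique[OF F B]
  \<comment> \<open>boundedness and sesquilinearity pass to the limit\<close>
  have "\<exists>S\<in>bounded_ops. norm S \<le> 1 \<and> (\<forall>\<xi> \<eta>. B \<xi> \<eta> = cinner \<xi> (blinfun_apply S \<eta>))"
  proof (rule sesquilinear_representation)
    fix \<xi> \<xi>' \<eta> \<eta>' :: 'h and c
    show "B (\<xi> + \<xi>') \<eta> = B \<xi> \<eta> + B \<xi>' \<eta>"
      using tendsto_add[OF B[of \<xi> \<eta>] B[of \<xi>' \<eta>]]
      by (intro uniq) (simp add: blinfun.add_right cinner_simps)
    show "B (c *\<^sub>C \<xi>) \<eta> = c * B \<xi> \<eta>"
      using tendsto_mult_left[OF B[of \<xi> \<eta>], of c]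
      by (intro uniq) (simp add: bounded_opsD[OF y] cinner_simps)
    show "B \<xi> (\<eta> + \<eta>') = B \<xi> \<eta> + B \<xi> \<eta>'"
      using tendsto_add[OF B[of \<xi> \<eta>] B[of \<xi> \<eta>']]
      by (intro uniq) (simp add: cinner_simps)
    show "B \<xi> (c *\<^sub>C \<eta>) = cnj c * B \<xi> \<eta>"
      using tendsto_mult_left[OF B[of \<xi> \<eta>], of "cnj c"]
      by (intro uniq) (simp add: cinner_simps)
    show "cmod (B \<xi> \<eta>) \<le> 1 * norm \<xi> * norm \<eta>"
      using f(1) by (force simp: K_def PiE_iff B_def)
  qed simp
  then obtain S where S: "S \<in> bounded_ops" "norm S \<le> 1"
    "\<And>\<xi> \<eta>. B \<xi> \<eta> = cinner \<xi> (blinfun_apply S \<eta>)" by blast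
  show thesis
  proof (rule that[of F "adj S"])
    show "F \<le> sequentially" by (simp add: F_def)
    show "norm (adj S) \<le> 1" using norm_adj_le[OF S(1)] S(2) by simp
    show "((\<lambda>n. cinner (blinfun_apply (y n) \<xi>) \<eta>) \<longlongrightarrow> cinner (blinfun_apply (adj S) \<xi>) \<eta>) F" for \<xi> \<eta>
      using B[of \<xi> \<eta>] by (simp add: S cinner_adj_left)
  qed (use F S adj_bounded_ops in auto)
qed

text \<open>Commuting with a fixed operator is preserved under weak limits, and \<open>N\<close> is a commutant.\<close>

lemma von_neumann_algebra_weakly_closed:
  assumes N: "von_neumann_algebra N" and y: "\<And>n. y n \<in> N"
    and F: "F \<noteq> bot" and T: "T \<in> bounded_ops"
    and lim: "\<And>\<xi> \<eta>. ((\<lambda>n. cinner (blinfun_apply (y n) \<xi>) \<eta>) \<longlongrightarrow> cinner (blinfun_apply T \<xi>) \<eta>) F"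
  shows "T \<in> N"
proof -
  have N': "N = commutant (commutant N)" using N by (simp add: von_neumann_algebra_def)
  have "blinfun_apply T (blinfun_apply s \<xi>) = blinfun_apply s (blinfun_apply T \<xi>)"
    if s: "s \<in> commutant N" for s \<xi>
  proof (rule cinner_ext_left)
    fix \<eta>
    have sb: "s \<in> bounded_ops" using s by (simp add: commutant_iff)
    have "blinfun_apply (y n) (blinfun_apply s \<xi>) = blinfun_apply s (blinfun_apply (y n) \<xi>)" for n
      using s y by (simp add: commutant_iff)
    then have "((\<lambda>n. cinner (blinfun_apply (y n) (blinfun_apply s \<xi>)) \<eta>)
        \<longlongrightarrow> cinner (blinfun_apply s (blinfun_apply T \<xi>)) \<eta>) F"
      using lim[of \<xi> "blinfun_apply (adj s) \<eta>"] by (simp add: cinner_adj_right[OF sb])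
    then show "cinner (blinfun_apply T (blinfun_apply s \<xi>)) \<eta>
        = cinner (blinfun_apply s (blinfun_apply T \<xi>)) \<eta>"
      by (rule tendsto_unique[OF F lim])
  qed
  then show ?thesis by (subst N') (simp add: commutant_iff T)
qed

lemma summable_norm_product:
  fixes \<xi> \<eta> :: "nat \<Rightarrow> 'a::real_normed_vector"
  assumes "summable (\<lambda>n. (norm (\<xi> n))\<^sup>2)" and "summable (\<lambda>n. (norm (\<eta> n))\<^sup>2)"
  shows "summable (\<lambda>n. norm (\<xi> n) * norm (\<eta> n))"
proof (rule summable_comparison_test[OF _ summable_add[OF assms]])
  have "norm (\<xi> n) * norm (\<eta> n) \<le> (norm (\<xi> n))\<^sup>2 + (norm (\<eta> n))\<^sup>2" for n
  proof -
    have "2 * (norm (\<xi> n) * norm (\<eta> n)) \<le> (norm (\<xi> n))\<^sup>2 + (norm (\<eta> n))\<^sup>2"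
      using sum_squares_bound[of "norm (\<xi> n)" "norm (\<eta> n)"] by (simp add: ac_simps)
    moreover have "0 \<le> norm (\<xi> n) * norm (\<eta> n)" by simp
    ultimately show ?thesis by linarith
  qed
  then show "\<exists>N. \<forall>n\<ge>N. norm (norm (\<xi> n) * norm (\<eta> n)) \<le> (norm (\<xi> n))\<^sup>2 + (norm (\<eta> n))\<^sup>2"
    by simp
qed

lemma cmod_cinner_blinfun_le:
  fixes x :: "'h::chilbert_space \<Rightarrow>\<^sub>L 'h"
  shows "cmod (cinner (blinfun_apply x \<xi>) \<eta>) \<le> norm x * (norm \<xi> * norm \<eta>)"
proof -
  have "cmod (cinner (blinfun_apply x \<xi>) \<eta>) \<le> norm (blinfun_apply x \<xi>) * norm \<eta>"
    by (rule cmod_cinner_le)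
  also have "\<dots> \<le> norm x * norm \<xi> * norm \<eta>"
    by (rule mult_right_mono[OF norm_blinfun]) simp
  finally show ?thesis by (simp add: mult.assoc)
qed

lemma normal_functional_properties:
  fixes M :: "('h::chilbert_space \<Rightarrow>\<^sub>L 'h) set"
  assumes \<phi>: "normal_functional M \<phi>" and M: "star_algebra M"
  shows normal_functional_add: "x \<in> M \<Longrightarrow> y \<in> M \<Longrightarrow> \<phi> (x + y) = \<phi> x + \<phi> y"
    and normal_functional_scale: "x \<in> M \<Longrightarrow> \<phi> (scaleC_op c x) = c * \<phi> x"
    and normal_functional_bound: "\<exists>K\<ge>0. \<forall>x\<in>M. cmod (\<phi> x) \<le> K * norm x"
    and normal_functional_translate: "a \<in> M \<Longrightarrow> normal_functional M (\<lambda>x. \<phi> (a o\<^sub>L x))"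
proof -
  interpret star_algebra M by (rule M)
  obtain \<xi> \<eta> where \<xi>: "summable (\<lambda>n. (norm (\<xi> n))\<^sup>2)" and \<eta>: "summable (\<lambda>n. (norm (\<eta> n))\<^sup>2)"
    and eq: "\<And>x. x \<in> M \<Longrightarrow> \<phi> x = (\<Sum>n. cinner (blinfun_apply x (\<xi> n)) (\<eta> n))"
    using \<phi> by (auto simp: normal_functional_def)
  note sum\<xi>\<eta> = summable_norm_product[OF \<xi> \<eta>]
  have abs_summable: "summable (\<lambda>n. cmod (cinner (blinfun_apply x (\<xi> n)) (\<eta> n)))" for x
    by (rule summable_comparison_test[OF _ summable_mult[OF sum\<xi>\<eta>, of "norm x"]])
       (simp add: cmod_cinner_blinfun_le)
  note summ = summable_norm_cancel[OF abs_summable]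
  show "\<phi> (x + y) = \<phi> x + \<phi> y" if "x \<in> M" "y \<in> M"
    using that by (simp add: eq add_mem blinfun.add_left cinner_simps suminf_add[OF summ summ])
  show "\<phi> (scaleC_op c x) = c * \<phi> x" if "x \<in> M"
    using that by (simp add: eq scale_mem cinner_simps suminf_mult[OF summ])
  show "\<exists>K\<ge>0. \<forall>x\<in>M. cmod (\<phi> x) \<le> K * norm x"
  proof (intro exI conjI ballI)
    show "0 \<le> (\<Sum>n. norm (\<xi> n) * norm (\<eta> n))" by (rule suminf_nonneg[OF sum\<xi>\<eta>]) simp
    fix x assume "x \<in> M"
    then have "cmod (\<phi> x) \<le> (\<Sum>n. cmod (cinner (blinfun_apply x (\<xi> n)) (\<eta> n)))"
      using summable_norm[OF abs_summable] by (simp add: eq)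
    also have "\<dots> \<le> (\<Sum>n. norm x * (norm (\<xi> n) * norm (\<eta> n)))"
      by (intro suminf_le abs_summable summable_mult sum\<xi>\<eta> cmod_cinner_blinfun_le)
    finally show "cmod (\<phi> x) \<le> (\<Sum>n. norm (\<xi> n) * norm (\<eta> n)) * norm x"
      by (simp only: suminf_mult[OF sum\<xi>\<eta>] mult.commute[of _ "norm x"])
  qed
  show "normal_functional M (\<lambda>x. \<phi> (a o\<^sub>L x))" if a: "a \<in> M"
    unfolding normal_functional_def
  proof (rule exI[of _ \<xi>], rule exI[of _ "\<lambda>n. blinfun_apply (adj a) (\<eta> n)"], intro conjI ballI)
    show "summable (\<lambda>n. (norm (blinfun_apply (adj a) (\<eta> n)))\<^sup>2)"
    proof (rule summable_comparison_test[OF _ summable_mult[OF \<eta>, of "(norm (adj a))\<^sup>2"]])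
      have "(norm (blinfun_apply (adj a) (\<eta> n)))\<^sup>2 \<le> (norm (adj a))\<^sup>2 * (norm (\<eta> n))\<^sup>2" for n
        using power_mono[OF norm_blinfun, of "adj a" "\<eta> n" 2] by (simp add: power_mult_distrib)
      then show "\<exists>N. \<forall>n\<ge>N. norm ((norm (blinfun_apply (adj a) (\<eta> n)))\<^sup>2)
          \<le> (norm (adj a))\<^sup>2 * (norm (\<eta> n))\<^sup>2" by simp
    qed
    show "\<phi> (a o\<^sub>L x) = (\<Sum>n. cinner (blinfun_apply x (\<xi> n)) (blinfun_apply (adj a) (\<eta> n)))"
      if "x \<in> M" for x
      using that a by (simp add: eq mult_mem flip: cinner_adj_right[OF bounded])
  qed (rule \<xi>)
qed

text \<open>Each summand \<open>\<langle>y\<^sub>n \<xi>\<^sub>k, \<eta>\<^sub>k\<rangle>\<close> converges and is dominated by the summable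
  \<open>\<parallel>\<xi>\<^sub>k\<parallel> \<parallel>\<eta>\<^sub>k\<parallel>\<close>, uniformly in \<open>n\<close>.\<close>

lemma normal_functional_weak_limit:
  fixes y :: "'i \<Rightarrow> 'h::chilbert_space \<Rightarrow>\<^sub>L 'h"
  assumes \<phi>: "normal_functional M \<phi>" and y: "\<And>n. y n \<in> M" "\<And>n. norm (y n) \<le> 1"
    and T: "T \<in> M" and F: "F \<noteq> bot"
    and lim: "\<And>\<xi> \<eta>. ((\<lambda>n. cinner (blinfun_apply (y n) \<xi>) \<eta>) \<longlongrightarrow> cinner (blinfun_apply T \<xi>) \<eta>) F"
  shows "((\<lambda>n. \<phi> (y n)) \<longlongrightarrow> \<phi> T) F"
proof -
  obtain \<xi> \<eta> where \<xi>\<eta>: "summable (\<lambda>n. (norm (\<xi> n))\<^sup>2)" "summable (\<lambda>n. (norm (\<eta> n))\<^sup>2)"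
    and eq: "\<And>x. x \<in> M \<Longrightarrow> \<phi> x = (\<Sum>n. cinner (blinfun_apply x (\<xi> n)) (\<eta> n))"
    using \<phi> by (auto simp: normal_functional_def)
  have "cmod (cinner (blinfun_apply (y n) (\<xi> k)) (\<eta> k)) \<le> norm (\<xi> k) * norm (\<eta> k)" for n k
    using order.trans[OF cmod_cinner_blinfun_le mult_right_mono[OF y(2)]] by force
  then have "((\<lambda>n. \<Sum>k. cinner (blinfun_apply (y n) (\<xi> k)) (\<eta> k))
      \<longlongrightarrow> (\<Sum>k. cinner (blinfun_apply T (\<xi> k)) (\<eta> k))) F"
    by (intro tannerys_theorem[THEN conjunct2, THEN conjunct2, OF lim _ summable_norm_product[OF \<xi>\<eta>] F])
       (simp add: case_prod_unfold)
  then show "((\<lambda>n. \<phi> (y n)) \<longlongrightarrow> \<phi> T) F" by (simp add: eq y T)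
qed

section \<open>The trace norm\<close>

lemma blinfun_compose_algebra:
  fixes x y z :: "'a::real_normed_vector \<Rightarrow>\<^sub>L 'a"
  shows blinfun_compose_assoc: "(x o\<^sub>L y) o\<^sub>L z = x o\<^sub>L (y o\<^sub>L z)"
    and blinfun_compose_add_left: "(x + y) o\<^sub>L z = (x o\<^sub>L z) + (y o\<^sub>L z)"
    and blinfun_compose_add_right: "z o\<^sub>L (x + y) = (z o\<^sub>L x) + (z o\<^sub>L y)"
    and blinfun_compose_diff_right: "z o\<^sub>L (x - y) = (z o\<^sub>L x) - (z o\<^sub>L y)"
    and blinfun_compose_scaleR_left: "(r *\<^sub>R x) o\<^sub>L z = r *\<^sub>R (x o\<^sub>L z)"
    and blinfun_compose_scaleR_right: "z o\<^sub>L (r *\<^sub>R x) = r *\<^sub>R (z o\<^sub>L x)"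
    and blinfun_compose_id: "id_blinfun o\<^sub>L x = x" "x o\<^sub>L id_blinfun = x"
  by (rule blinfun_eqI; simp add: blinfun.bilinear_simps)+

text \<open>The quotients of consecutive terms increase, so an increase at the first step would propagate to
  geometric growth.\<close>

lemma log_convex_bounded_decreasing:
  fixes a :: "nat \<Rightarrow> real"
  assumes nonneg: "\<And>k. 0 \<le> a k" and convex: "\<And>k. (a (Suc k))\<^sup>2 \<le> a k * a (Suc (Suc k))"
    and bound: "\<And>k. a k \<le> B"
  shows "a 1 \<le> a 0"
proof (rule ccontr)
  assume "\<not> a 1 \<le> a 0"
  then have less: "a 0 < a 1" by simp
  have a0: "0 < a 0"
  proof (rule ccontr)
    assume "\<not> 0 < a 0"
    with nonneg[of 0] have "a 0 = 0" by simp
    with convex[of 0] less show False by simp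
  qed
  define q where "q = a 1 / a 0"
  have q: "1 < q" using less a0 by (simp add: q_def)
  have step: "0 < a k \<and> q * a k \<le> a (Suc k)" for k
  proof (induction k)
    case 0
    show ?case using a0 by (simp add: q_def)
  next
    case (Suc k)
    then have pos: "0 < a (Suc k)" using q by (smt (verit) mult_pos_pos)
    have "a k * (q * a (Suc k)) \<le> a (Suc k) * a (Suc k)"
      using Suc mult_right_mono[of "q * a k" "a (Suc k)" "a (Suc k)"] pos by (simp add: ac_simps)
    also have "\<dots> \<le> a k * a (Suc (Suc k))" using convex[of k] by (simp add: power2_eq_square)
    finally show ?case using Suc pos by simp
  qed
  have grow: "q ^ k * a 0 \<le> a k" for k
  proof (induction k)
    case (Suc k)
    have "q * (q ^ k * a 0) \<le> q * a k" using Suc q by (intro mult_left_mono) auto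
    then show ?case using step[of k] by (simp add: mult.assoc)
  qed simp
  obtain n where "B / a 0 < q ^ n" using real_arch_pow[OF q] by blast
  then have "B < q ^ n * a 0" using a0 by (simp add: field_simps)
  with grow[of n] bound[of n] show False by linarith
qed

locale tracial =
  fixes M :: "('h::chilbert_space \<Rightarrow>\<^sub>L 'h) set" and \<tau> :: "('h \<Rightarrow>\<^sub>L 'h) \<Rightarrow> complex"
  assumes tracial_vN: "tracial_von_neumann_algebra M \<tau>"
begin

lemma vN: "von_neumann_algebra M"
  and normal: "normal_functional M \<tau>"
  and tau_id: "\<tau> id_blinfun = 1"
  and tau_adj_mult: "x \<in> M \<Longrightarrow> \<tau> (adj x o\<^sub>L x) \<in> \<real>\<^sub>\<ge>\<^sub>0"
  and tau_faithful: "x \<in> M \<Longrightarrow> \<tau> (adj x o\<^sub>L x) = 0 \<Longrightarrow> x = 0"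
  and tau_commute: "x \<in> M \<Longrightarrow> y \<in> M \<Longrightarrow> \<tau> (x o\<^sub>L y) = \<tau> (y o\<^sub>L x)"
  using tracial_vN
  by (auto simp: tracial_von_neumann_algebra_def faithful_normal_tracial_state_def)

sublocale star_algebra M by (rule von_neumann_algebra_star_algebra[OF vN])

lemmas star = star_algebra_axioms
lemmas mem = add_mem mult_mem scale_mem id_mem adj_mem scaleR_mem uminus_mem diff_mem zero_mem
lemmas tau_add = normal_functional_add[OF normal star]
lemmas tau_scale = normal_functional_scale[OF normal star]

lemma tau_scaleR: "x \<in> M \<Longrightarrow> \<tau> (r *\<^sub>R x) = r * \<tau> x"
  using tau_scale[of x "of_real r"] by (simp add: scaleC_op_of_real)

lemma tau_uminus: "x \<in> M \<Longrightarrow> \<tau> (- x) = - \<tau> x"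
  using tau_scaleR[of x "-1"] by simp

lemma tau_diff: "x \<in> M \<Longrightarrow> y \<in> M \<Longrightarrow> \<tau> (x - y) = \<tau> x - \<tau> y"
  using tau_add[of x "-y"] tau_uminus[of y] uminus_mem[of y] by simp

lemma norm2_nonneg: "x \<in> M \<Longrightarrow> 0 \<le> norm2 \<tau> x"
  using tau_adj_mult[of x] by (auto simp: norm2_def complex_nonneg_Reals_iff)

lemma tau_adj_mult_eq: "x \<in> M \<Longrightarrow> \<tau> (adj x o\<^sub>L x) = of_real ((norm2 \<tau> x)\<^sup>2)"
  using tau_adj_mult[of x] by (simp add: norm2_def complex_nonneg_Reals_iff complex_eq_iff)

lemma norm2_square: "x \<in> M \<Longrightarrow> (norm2 \<tau> x)\<^sup>2 = Re (\<tau> (adj x o\<^sub>L x))"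
  by (simp add: tau_adj_mult_eq)

lemma norm2_eq_0: "x \<in> M \<Longrightarrow> norm2 \<tau> x = 0 \<Longrightarrow> x = 0"
  using tau_faithful[of x] by (simp add: tau_adj_mult_eq)

text \<open>Positivity on \<open>1 + x\<close> and \<open>\<i> + x\<close> forces \<open>\<tau>(x\<^sup>*) + \<tau>(x)\<close> to be real and
  \<open>\<tau>(x\<^sup>*) - \<tau>(x)\<close> to be imaginary.\<close>

lemma tau_adj:
  assumes x: "x \<in> M" shows "\<tau> (adj x) = cnj (\<tau> x)"
proof -
  have expand: "adj (scaleC_op c id_blinfun + x) o\<^sub>L (scaleC_op c id_blinfun + x)
      = scaleC_op (cnj c * c) id_blinfun + scaleC_op (cnj c) x + scaleC_op c (adj x) + (adj x o\<^sub>L x)"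
    for c
    by (rule blinfun_eqI)
       (simp add: adj_add adj_scale adj_id mem x blinfun.bilinear_simps scaleC_add_right
         scaleC_scaleC bounded_opsD[OF bounded])
  have "Im (\<tau> (adj (scaleC_op c id_blinfun + x) o\<^sub>L (scaleC_op c id_blinfun + x))) = 0" for c
    using tau_adj_mult[of "scaleC_op c id_blinfun + x"]
    by (simp add: mem x complex_nonneg_Reals_iff)
  then have "Im (cnj c * \<tau> x + c * \<tau> (adj x)) = 0" for c
    using tau_adj_mult[OF x]
    by (simp add: expand tau_add tau_scale tau_id mem x complex_nonneg_Reals_iff)
  from this[of 1] this[of \<i>] show ?thesis by (simp add: complex_eq_iff)
qed

lemma norm2_adj: "x \<in> M \<Longrightarrow> norm2 \<tau> (adj x) = norm2 \<tau> x"
  by (simp add: norm2_def adj_adj tau_commute mem)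

lemma norm2_scaleR: "x \<in> M \<Longrightarrow> norm2 \<tau> (r *\<^sub>R x) = \<bar>r\<bar> * norm2 \<tau> x"
  by (simp add: norm2_def adj_scaleR blinfun_compose_scaleR_left blinfun_compose_scaleR_right
      tau_scaleR mem real_sqrt_mult mult.assoc[symmetric])

lemma norm2_uminus: "x \<in> M \<Longrightarrow> norm2 \<tau> (- x) = norm2 \<tau> x"
  using norm2_scaleR[of x "-1"] by simp

lemma norm2_add_square:
  assumes "x \<in> M" "y \<in> M"
  shows "(norm2 \<tau> (x + y))\<^sup>2 = (norm2 \<tau> x)\<^sup>2 + 2 * Re (\<tau> (adj x o\<^sub>L y)) + (norm2 \<tau> y)\<^sup>2"
proof -
  have "adj (adj x o\<^sub>L y) = adj y o\<^sub>L x" using assms by (simp add: adj_mult adj_adj mem)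
  then have "Re (\<tau> (adj y o\<^sub>L x)) = Re (\<tau> (adj x o\<^sub>L y))"
    using tau_adj[of "adj x o\<^sub>L y"] assms by (simp add: mem)
  with assms show ?thesis
    by (simp add: norm2_square adj_add blinfun_compose_add_left blinfun_compose_add_right tau_add mem)
qed

lemma Re_tau_adj_mult_le:
  assumes "x \<in> M" "y \<in> M"
  shows "Re (\<tau> (adj x o\<^sub>L y)) \<le> norm2 \<tau> x * norm2 \<tau> y"
proof -
  have "0 \<le> (norm2 \<tau> x)\<^sup>2 + 2 * t * Re (\<tau> (adj x o\<^sub>L y)) + t\<^sup>2 * (norm2 \<tau> y)\<^sup>2" for t
    using norm2_add_square[of x "t *\<^sub>R y"] zero_le_power2[of "norm2 \<tau> (x + t *\<^sub>R y)"] assms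
    by (simp add: mem norm2_scaleR blinfun_compose_scaleR_right tau_scaleR power_mult_distrib
        algebra_simps)
  from real_quadratic_nonneg_imp[OF this] show ?thesis
    using assms by (simp add: norm2_nonneg)
qed

lemma norm2_triangle:
  assumes "x \<in> M" "y \<in> M" shows "norm2 \<tau> (x + y) \<le> norm2 \<tau> x + norm2 \<tau> y"
proof (rule power2_le_imp_le)
  show "(norm2 \<tau> (x + y))\<^sup>2 \<le> (norm2 \<tau> x + norm2 \<tau> y)\<^sup>2"
    using Re_tau_adj_mult_le[OF assms] by (simp add: norm2_add_square assms power2_sum)
  show "0 \<le> norm2 \<tau> x + norm2 \<tau> y" using assms by (simp add: norm2_nonneg)
qed

lemma norm2_le_norm: "\<exists>K. \<forall>x\<in>M. norm2 \<tau> x \<le> K * norm x"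
proof -
  obtain K where K: "0 \<le> K" "\<And>x. x \<in> M \<Longrightarrow> cmod (\<tau> x) \<le> K * norm x"
    using normal_functional_bound[OF normal star] by blast
  have "norm2 \<tau> x \<le> sqrt K * norm x" if x: "x \<in> M" for x
  proof -
    have "Re (\<tau> (adj x o\<^sub>L x)) \<le> K * norm (adj x o\<^sub>L x)"
      using K(2)[of "adj x o\<^sub>L x"] complex_Re_le_cmod[of "\<tau> (adj x o\<^sub>L x)"] x by (simp add: mem)
    also have "\<dots> \<le> K * (norm x)\<^sup>2"
      using norm_blinfun_compose[of "adj x" x] K(1) x
      by (simp add: norm_adj power2_eq_square mult_left_mono)
    finally have "sqrt (Re (\<tau> (adj x o\<^sub>L x))) \<le> sqrt (K * (norm x)\<^sup>2)" by simp
    then show ?thesis by (simp add: norm2_def real_sqrt_mult)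
  qed
  then show ?thesis by blast
qed

text \<open>For a self-adjoint contraction \<open>h\<close> the numbers \<open>\<parallel>h\<^sup>k y\<parallel>\<^sub>2\<close> form a log-convex sequence, by
  the Cauchy-Schwarz inequality, which is bounded by normality of \<open>\<tau>\<close>.\<close>

lemma norm2_selfadjoint_contraction_le:
  assumes h: "h \<in> M" "adj h = h" "norm h \<le> 1" and y: "y \<in> M"
  shows "norm2 \<tau> (h o\<^sub>L y) \<le> norm2 \<tau> y"
proof -
  define z where "z k = ((\<lambda>w. h o\<^sub>L w) ^^ k) y" for k
  have z0: "z 0 = y" and zS: "z (Suc k) = h o\<^sub>L z k" for k by (simp_all add: z_def)
  have zM: "z k \<in> M" for k by (induction k) (simp_all add: z0 zS y h mem)
  have zn: "norm (z k) \<le> norm y" for k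
  proof (induction k)
    case (Suc k)
    have "norm (z (Suc k)) \<le> norm h * norm (z k)" unfolding zS by (rule norm_blinfun_compose)
    also have "\<dots> \<le> 1 * norm (z k)" by (intro mult_right_mono h norm_ge_zero)
    finally show ?case using Suc by simp
  qed (simp add: z0)
  obtain K where K: "\<And>x. x \<in> M \<Longrightarrow> norm2 \<tau> x \<le> K * norm x" using norm2_le_norm by blast
  have "norm2 \<tau> (z 1) \<le> norm2 \<tau> (z 0)"
  proof (rule log_convex_bounded_decreasing[of "\<lambda>k. norm2 \<tau> (z k)"])
    show "norm2 \<tau> (z k) \<le> \<bar>K\<bar> * norm y" for k
    proof -
      have "norm2 \<tau> (z k) \<le> \<bar>K\<bar> * norm (z k)"
        by (rule order.trans[OF K[OF zM] mult_right_mono]) auto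
      also have "\<dots> \<le> \<bar>K\<bar> * norm y" by (intro mult_left_mono zn) simp
      finally show ?thesis .
    qed
    show "(norm2 \<tau> (z (Suc k)))\<^sup>2 \<le> norm2 \<tau> (z k) * norm2 \<tau> (z (Suc (Suc k)))" for k
    proof -
      have "adj (z (Suc k)) o\<^sub>L z (Suc k) = adj (z k) o\<^sub>L z (Suc (Suc k))"
        by (simp add: zS adj_mult zM mem h blinfun_compose_assoc)
      with Re_tau_adj_mult_le[of "z k" "z (Suc (Suc k))"] show ?thesis
        by (simp add: norm2_square zM)
    qed
  qed (simp add: norm2_nonneg zM)
  then show ?thesis by (simp add: zS z0)
qed

text \<open>Left multiplication by \<open>x\<close> is reduced to the self-adjoint contraction \<open>x\<^sup>*x\<close> through
  \<open>\<parallel>x y\<parallel>\<^sub>2\<^sup>2 = \<langle>x\<^sup>*x y, y\<rangle>\<close>.\<close>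

lemma norm2_contraction_le:
  assumes x: "x \<in> M" "norm x \<le> 1" and y: "y \<in> M"
  shows "norm2 \<tau> (x o\<^sub>L y) \<le> norm2 \<tau> y"
proof (rule power2_le_imp_le[OF _ norm2_nonneg[OF y]])
  define h where "h = adj x o\<^sub>L x"
  have h: "h \<in> M" "adj h = h" using x by (simp_all add: h_def mem adj_mult adj_adj)
  have "norm h \<le> norm x * norm x"
    unfolding h_def using norm_blinfun_compose[of "adj x" x] x by (simp add: norm_adj)
  also have "\<dots> \<le> 1 * 1" using x by (intro mult_mono) auto
  finally have "norm2 \<tau> (h o\<^sub>L y) \<le> norm2 \<tau> y"
    using h y by (intro norm2_selfadjoint_contraction_le) auto
  moreover have "adj (x o\<^sub>L y) o\<^sub>L (x o\<^sub>L y) = adj y o\<^sub>L (h o\<^sub>L y)"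
    using x y by (simp add: h_def adj_mult blinfun_compose_assoc)
  then have "(norm2 \<tau> (x o\<^sub>L y))\<^sup>2 \<le> norm2 \<tau> y * norm2 \<tau> (h o\<^sub>L y)"
    using Re_tau_adj_mult_le[of y "h o\<^sub>L y"] h x y by (simp add: norm2_square mem)
  ultimately show "(norm2 \<tau> (x o\<^sub>L y))\<^sup>2 \<le> (norm2 \<tau> y)\<^sup>2"
    using mult_left_mono[of "norm2 \<tau> (h o\<^sub>L y)" "norm2 \<tau> y" "norm2 \<tau> y"] norm2_nonneg[OF y]
    by (simp add: power2_eq_square)
qed

lemma norm2_mult_le:
  assumes x: "x \<in> M" "norm x \<le> c" and y: "y \<in> M"
  shows "norm2 \<tau> (x o\<^sub>L y) \<le> c * norm2 \<tau> y"
proof (cases "c = 0")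
  case True
  with x norm2_scaleR[OF x(1), of 0] show ?thesis by simp
next
  case False
  with x have c: "0 < c" using norm_ge_zero[of x] by linarith
  have "norm2 \<tau> (((1 / c) *\<^sub>R x) o\<^sub>L y) \<le> norm2 \<tau> y"
    using x y c by (intro norm2_contraction_le) (auto simp: mem)
  then show ?thesis
    using x y c by (simp add: blinfun_compose_scaleR_left norm2_scaleR mem field_simps)
qed

text \<open>Taking adjoints is isometric for \<open>\<parallel>\<cdot>\<parallel>\<^sub>2\<close> by traciality, which turns right multiplication into
  left multiplication.\<close>

lemma norm2_mult_le':
  assumes x: "x \<in> M" and y: "y \<in> M" "norm y \<le> c"
  shows "norm2 \<tau> (x o\<^sub>L y) \<le> c * norm2 \<tau> x"
proof -
  have "norm2 \<tau> (x o\<^sub>L y) = norm2 \<tau> (adj y o\<^sub>L adj x)"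
    using x y norm2_adj[of "x o\<^sub>L y"] by (simp add: adj_mult mem)
  also have "\<dots> \<le> c * norm2 \<tau> (adj x)"
    using x y by (intro norm2_mult_le) (auto simp: mem norm_adj)
  finally show ?thesis using x by (simp add: norm2_adj)
qed

end

section \<open>Positive operators and contractions\<close>

text \<open>Polarization: the values \<open>\<langle>Tz, z\<rangle>\<close> are real at \<open>z = x + y\<close> and \<open>z = x + \<i>y\<close>.\<close>

lemma positive_op_selfadjoint:
  assumes T: "positive_op T" shows "adj T = T"
proof (rule adj_eqI)
  show b: "T \<in> bounded_ops" using T by (simp add: positive_op_def)
  fix x y
  let ?q = "\<lambda>z. cinner (blinfun_apply T z) z"
  have real: "Im (?q z) = 0" for z
    using T by (auto simp: positive_op_def complex_nonneg_Reals_iff)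
  have "Im (cinner (blinfun_apply T x) y + cinner (blinfun_apply T y) x) = 0"
    using real[of "x + y"] real[of x] real[of y] by (simp add: blinfun.add_right cinner_simps)
  moreover have "Re (cinner (blinfun_apply T x) y) = Re (cinner (blinfun_apply T y) x)"
    using real[of "x + \<i> *\<^sub>C y"] real[of x] real[of y]
    by (simp add: blinfun.add_right bounded_opsD[OF b] cinner_simps)
  ultimately have "cinner (blinfun_apply T x) y = cnj (cinner (blinfun_apply T y) x)"
    by (simp add: complex_eq_iff)
  then show "cinner (blinfun_apply T x) y = cinner x (blinfun_apply T y)"
    by (metis cinner_commute)
qed

text \<open>With \<open>\<zeta> = s \<xi> - x \<xi>\<close>, positivity of \<open>\<langle>x \<zeta>, \<zeta>\<rangle>\<close> gives \<open>\<parallel>x \<xi>\<parallel>\<^sup>2 \<le> s \<langle>x \<xi>, \<xi>\<rangle>\<close>, which is the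
  operator inequality \<open>x\<^sup>2 \<le> s x\<close>.\<close>

lemma norm_minus_positive_le:
  fixes x :: "'h::chilbert_space \<Rightarrow>\<^sub>L 'h"
  assumes pos: "positive_op x" and s: "norm x \<le> s" "0 < s"
  shows "norm (s *\<^sub>R id_blinfun - x) \<le> s"
proof (rule norm_blinfun_bound)
  fix \<xi>
  let ?x = "blinfun_apply x"
  have b: "x \<in> bounded_ops" using pos by (simp add: positive_op_def)
  have sa: "cinner (?x \<eta>) \<zeta> = cinner \<eta> (?x \<zeta>)" for \<eta> \<zeta>
    using cinner_adj_right[OF b] positive_op_selfadjoint[OF pos] by simp
  define r where "r = Re (cinner (?x \<xi>) \<xi>)"
  define q where "q = (norm (?x \<xi>))\<^sup>2"
  define k where "k = Re (cinner (?x (?x \<xi>)) (?x \<xi>))"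
  have cross: "Re (cinner (?x (?x \<xi>)) \<xi>) = q" "Re (cinner (?x \<xi>) (?x \<xi>)) = q"
    by (simp_all add: sa cinner_self q_def flip: sa[of "?x \<xi>" \<xi>])
  have "0 \<le> Re (cinner (?x (s *\<^sub>R \<xi> - ?x \<xi>)) (s *\<^sub>R \<xi> - ?x \<xi>))"
    using pos by (auto simp: positive_op_def complex_nonneg_Reals_iff)
  also have "\<dots> = s * (s * r) - 2 * (s * q) + k"
    by (simp add: blinfun.diff_right blinfun.scaleR_right cinner_simps cross r_def k_def algebra_simps)
  also have "k \<le> s * q"
  proof -
    have "k \<le> norm x * (norm (?x \<xi>) * norm (?x \<xi>))"
      unfolding k_def by (rule order.trans[OF complex_Re_le_cmod cmod_cinner_blinfun_le])
    also have "\<dots> \<le> s * q"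
      unfolding q_def power2_eq_square by (rule mult_right_mono[OF s(1)]) simp
    finally show ?thesis .
  qed
  finally have "s * q \<le> s * (s * r)" by (simp add: mult.commute)
  then have "q \<le> s * r" using s(2) by simp
  moreover have "0 \<le> q" by (simp add: q_def)
  ultimately have "q \<le> 2 * (s * r)" by linarith
  then have "(norm (s *\<^sub>R \<xi> - ?x \<xi>))\<^sup>2 \<le> (s * norm \<xi>)\<^sup>2"
    using Re_cinner_commute[of \<xi> "?x \<xi>"]
    by (simp add: norm_diff_square cinner_simps power_mult_distrib q_def r_def)
  then have "norm (s *\<^sub>R \<xi> - ?x \<xi>) \<le> s * norm \<xi>"
    by (rule power2_le_imp_le) (use s in simp)
  then show "norm (blinfun_apply (s *\<^sub>R id_blinfun - x) \<xi>) \<le> s * norm \<xi>"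
    by (simp add: blinfun.diff_left blinfun.scaleR_left)
qed (use s in simp)

text \<open>In \<open>\<parallel>\<xi> - t p\<^sup>2 \<xi>\<parallel>\<^sup>2 = \<parallel>\<xi>\<parallel>\<^sup>2 - 2 t \<parallel>p \<xi>\<parallel>\<^sup>2 + t\<^sup>2 \<parallel>p\<^sup>2 \<xi>\<parallel>\<^sup>2\<close> the last term is at most
  \<open>t \<parallel>p \<xi>\<parallel>\<^sup>2\<close>.\<close>

lemma norm_id_minus_square_le:
  fixes p :: "'h::chilbert_space \<Rightarrow>\<^sub>L 'h"
  assumes p: "p \<in> bounded_ops" "adj p = p" "norm p \<le> 1" and t: "0 \<le> t" "t \<le> 1"
  shows "norm (id_blinfun - t *\<^sub>R (p o\<^sub>L p)) \<le> 1"
proof (rule norm_blinfun_bound)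
  fix \<xi> :: 'h
  let ?P = "blinfun_apply p"
  have "cinner \<xi> (?P (?P \<xi>)) = cinner (?P \<xi>) (?P \<xi>)"
    using cinner_adj_right[OF p(1), of \<xi> "?P \<xi>"] p(2) by simp
  then have re: "Re (cinner \<xi> (?P (?P \<xi>))) = (norm (?P \<xi>))\<^sup>2" by (simp add: cinner_self)
  have "norm (?P (?P \<xi>)) \<le> 1 * norm (?P \<xi>)"
    by (rule order.trans[OF norm_blinfun mult_right_mono[OF p(3)]]) simp
  then have sq: "(norm (?P (?P \<xi>)))\<^sup>2 \<le> (norm (?P \<xi>))\<^sup>2" by (simp add: power_mono)
  have "t\<^sup>2 * (norm (?P (?P \<xi>)))\<^sup>2 \<le> t * (norm (?P \<xi>))\<^sup>2"
    using t sq by (intro mult_mono) (auto simp: power2_eq_square mult_left_le)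
  moreover have "0 \<le> t * (norm (?P \<xi>))\<^sup>2" using t by simp
  ultimately have "(norm (\<xi> - t *\<^sub>R ?P (?P \<xi>)))\<^sup>2 \<le> (norm \<xi>)\<^sup>2"
    by (simp add: norm_diff_square cinner_scaleR_right re power_mult_distrib)
  then have "norm (\<xi> - t *\<^sub>R ?P (?P \<xi>)) \<le> norm \<xi>" by (rule power2_le_imp_le) simp
  then show "norm (blinfun_apply (id_blinfun - t *\<^sub>R (p o\<^sub>L p)) \<xi>) \<le> 1 * norm \<xi>"
    by (simp add: blinfun.diff_left blinfun.scaleR_left)
qed simp

text \<open>With \<open>D = 1 - y\<^sup>*y\<close> one has \<open>(1 - yy\<^sup>*) y = y D\<close> and \<open>\<parallel>D \<xi>\<parallel>\<^sup>2 \<le> \<langle>D \<xi>, \<xi>\<rangle> = \<parallel>\<xi>\<parallel>\<^sup>2 - \<parallel>y \<xi>\<parallel>\<^sup>2\<close>, so the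
  perturbation stays inside the slack that \<open>y\<close> leaves in the unit ball.\<close>

lemma norm_defect_perturbation_le:
  fixes y a :: "'h::chilbert_space \<Rightarrow>\<^sub>L 'h"
  assumes y: "y \<in> bounded_ops" "norm y \<le> 1" and a: "norm a \<le> 1" and t: "0 \<le> t" "t \<le> 1 / 3"
  shows "norm (y + t *\<^sub>R ((id_blinfun - (y o\<^sub>L adj y)) o\<^sub>L (a o\<^sub>L (id_blinfun - (adj y o\<^sub>L y))))) \<le> 1"
proof (rule norm_blinfun_bound)
  fix \<xi> :: 'h
  let ?y = "blinfun_apply y" and ?y' = "blinfun_apply (adj y)"
  have contr: "norm (blinfun_apply b \<eta>) \<le> norm \<eta>" if "norm b \<le> 1" for b :: "'h \<Rightarrow>\<^sub>L 'h" and \<eta>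
    using order.trans[OF norm_blinfun mult_right_mono[OF that]] by force
  have y': "norm (adj y) \<le> 1" using norm_adj_le[OF y(1)] y(2) by linarith
  define D where "D = \<xi> - ?y' (?y \<xi>)"
  define v where "v = blinfun_apply a D"
  define w where "w = v - ?y (?y' v)"
  have D: "(norm D)\<^sup>2 \<le> (norm \<xi>)\<^sup>2 - (norm (?y \<xi>))\<^sup>2"
  proof -
    have "Re (cinner \<xi> (?y' (?y \<xi>))) = (norm (?y \<xi>))\<^sup>2"
      by (simp add: cinner_self flip: cinner_adj_right[OF y(1)])
    moreover have "(norm (?y' (?y \<xi>)))\<^sup>2 \<le> (norm (?y \<xi>))\<^sup>2"
      by (intro power_mono contr[OF y']) simp
    ultimately show ?thesis by (simp add: D_def norm_diff_square)
  qed
  have v: "norm v \<le> norm D" unfolding v_def by (rule contr[OF a])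
  have w: "norm w \<le> norm v"
  proof -
    have "Re (cinner v (?y (?y' v))) = (norm (?y' v))\<^sup>2"
      by (simp add: cinner_self flip: cinner_adj_left[OF y(1)])
    moreover have "(norm (?y (?y' v)))\<^sup>2 \<le> (norm (?y' v))\<^sup>2"
      by (intro power_mono contr[OF y(2)]) simp
    ultimately have "(norm w)\<^sup>2 \<le> (norm v)\<^sup>2"
      using zero_le_power2[of "norm (?y' v)"] unfolding w_def norm_diff_square by linarith
    then show ?thesis by (rule power2_le_imp_le) simp
  qed
  have "cinner (?y \<xi>) w = cinner (?y D) v"
    by (simp add: w_def D_def cinner_simps blinfun.diff_right cinner_adj_right[OF y(1)]
        cinner_adj_left[OF y(1)] flip: cinner_adj_right[OF y(1), of _ "?y' v"])
  then have "Re (cinner (?y \<xi>) w) \<le> norm (?y D) * norm v" using Re_cinner_le by metis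
  also have "\<dots> \<le> norm D * norm D" by (intro mult_mono contr y v) auto
  finally have cross: "Re (cinner (?y \<xi>) w) \<le> (norm D)\<^sup>2" by (simp add: power2_eq_square)
  have w2: "(norm w)\<^sup>2 \<le> (norm D)\<^sup>2" using w v by (intro power_mono) auto
  have "2 * (t * Re (cinner (?y \<xi>) w)) + t\<^sup>2 * (norm w)\<^sup>2 \<le> 2 * (t * (norm D)\<^sup>2) + t\<^sup>2 * (norm D)\<^sup>2"
    using t cross w2 by (intro add_mono mult_left_mono) auto
  also have "\<dots> = (2 * t + t\<^sup>2) * (norm D)\<^sup>2" by (simp add: algebra_simps)
  also have "\<dots> \<le> 1 * (norm D)\<^sup>2"
  proof (rule mult_right_mono)
    have "t\<^sup>2 \<le> (1 / 3) * t" using t unfolding power2_eq_square by (intro mult_right_mono) auto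
    with t show "2 * t + t\<^sup>2 \<le> 1" by simp
  qed simp
  finally have "(norm (?y \<xi> + t *\<^sub>R w))\<^sup>2 \<le> (norm \<xi>)\<^sup>2"
    using D by (simp add: norm_add_square cinner_scaleR_right power_mult_distrib)
  then have "norm (?y \<xi> + t *\<^sub>R w) \<le> norm \<xi>" by (rule power2_le_imp_le) simp
  then show "norm (blinfun_apply (y + t *\<^sub>R ((id_blinfun - (y o\<^sub>L adj y)) o\<^sub>L (a o\<^sub>L (id_blinfun - (adj y o\<^sub>L y))))) \<xi>)
      \<le> 1 * norm \<xi>"
    by (simp add: w_def v_def D_def blinfun.diff_left blinfun.add_left blinfun.scaleR_left)
qed simp

definition op_power :: "('h::real_normed_vector \<Rightarrow>\<^sub>L 'h) \<Rightarrow> nat \<Rightarrow> 'h \<Rightarrow>\<^sub>L 'h"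
  where "op_power h m = ((\<lambda>w. h o\<^sub>L w) ^^ m) id_blinfun"

lemma op_power_simps [simp]:
  "op_power h 0 = id_blinfun" "op_power h (Suc m) = h o\<^sub>L op_power h m"
  by (simp_all add: op_power_def)

lemma op_power_commute: "h o\<^sub>L op_power h m = op_power h m o\<^sub>L h"
proof (induction m)
  case (Suc m)
  have "h o\<^sub>L op_power h (Suc m) = h o\<^sub>L (op_power h m o\<^sub>L h)" by (simp add: Suc)
  then show ?case by (simp add: blinfun_compose_assoc)
qed (simp add: blinfun_compose_id)

lemma norm_op_power_le: "norm h \<le> 1 \<Longrightarrow> norm (op_power h m) \<le> 1"
proof (induction m)
  case (Suc m)
  have "norm (op_power h (Suc m)) \<le> norm h * norm (op_power h m)"
    using norm_blinfun_compose[of h "op_power h m"] by simp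
  also have "\<dots> \<le> 1 * 1" using Suc by (intro mult_mono) auto
  finally show ?case by simp
qed (simp add: norm_blinfun_id_le)

text \<open>Lets the powers of \<open>yy\<^sup>*\<close> inherit the decay of those of \<open>y\<^sup>*y\<close>.\<close>

lemma op_power_swap:
  fixes x y :: "'a::real_normed_vector \<Rightarrow>\<^sub>L 'a"
  shows "op_power (x o\<^sub>L y) (Suc m) = x o\<^sub>L (op_power (y o\<^sub>L x) m o\<^sub>L y)"
  by (induction m) (simp_all add: blinfun_compose_id blinfun_compose_assoc)

context star_algebra
begin

lemma op_power_mem: "h \<in> M \<Longrightarrow> op_power h m \<in> M"
  by (induction m) (simp_all add: id_mem mult_mem)

lemma adj_op_power: "h \<in> M \<Longrightarrow> adj h = h \<Longrightarrow> adj (op_power h m) = op_power h m"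
  by (induction m) (simp_all add: adj_id adj_mult op_power_mem op_power_commute)

text \<open>The factor is the geometric sum \<open>1 + h + \<dots> + h\<^sup>m\<^sup>-\<^sup>1\<close>.\<close>

lemma id_minus_op_power_factor:
  assumes h: "h \<in> M"
  shows "\<exists>s\<in>M. id_blinfun - op_power h m = (id_blinfun - h) o\<^sub>L s \<and>
    id_blinfun - op_power h m = s o\<^sub>L (id_blinfun - h)"
proof (induction m)
  case 0
  show ?case by (rule bexI[of _ 0]) (simp_all add: zero_mem blinfun_eqI)
next
  case (Suc m)
  then obtain s where s: "s \<in> M" "id_blinfun - op_power h m = (id_blinfun - h) o\<^sub>L s"
    "id_blinfun - op_power h m = s o\<^sub>L (id_blinfun - h)" by blast
  have split: "id_blinfun - op_power h (Suc m)
      = (id_blinfun - h) + (h o\<^sub>L (id_blinfun - op_power h m))"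
    by (rule blinfun_eqI) (simp add: blinfun.bilinear_simps)
  show ?case
  proof (intro bexI conjI)
    show "id_blinfun - op_power h (Suc m) = (id_blinfun - h) o\<^sub>L (id_blinfun + (h o\<^sub>L s))"
      unfolding split s(2) by (rule blinfun_eqI) (simp add: blinfun.bilinear_simps)
    show "id_blinfun - op_power h (Suc m) = (id_blinfun + (h o\<^sub>L s)) o\<^sub>L (id_blinfun - h)"
      unfolding split s(3) by (rule blinfun_eqI) (simp add: blinfun.bilinear_simps)
    show "id_blinfun + (h o\<^sub>L s) \<in> M" by (intro add_mem mult_mem id_mem h s)
  qed
qed

end

section \<open>The trace-preserving conditional expectation\<close>

locale tracial_subalgebra = tracial M \<tau> for M :: "('h::chilbert_space \<Rightarrow>\<^sub>L 'h) set" and \<tau> +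
  fixes N :: "('h::chilbert_space \<Rightarrow>\<^sub>L 'h) set"
  assumes N: "N \<in> Sub M"
begin

lemma N_vN: "von_neumann_algebra N" and sub: "x \<in> N \<Longrightarrow> x \<in> M"
  using N by (auto simp: Sub_def)

sublocale N: star_algebra N by (rule von_neumann_algebra_star_algebra[OF N_vN])

lemmas N_mem = N.add_mem N.mult_mem N.scale_mem N.id_mem N.adj_mem N.scaleR_mem N.uminus_mem
  N.diff_mem N.zero_mem

text \<open>A minimising sequence has a weak cluster point \<open>T\<close> in the ball. With \<open>u = x - T\<close>, the number
  \<open>\<parallel>u\<parallel>\<^sub>2\<^sup>2\<close> is a cluster value of \<open>Re \<tau>(u\<^sup>*(x - y\<^sub>n)) \<le> \<parallel>u\<parallel>\<^sub>2 \<parallel>x - y\<^sub>n\<parallel>\<^sub>2\<close>, so that \<open>\<parallel>u\<parallel>\<^sub>2\<close> does not exceed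
  the infimum; this is lower semicontinuity of \<open>\<parallel>\<cdot>\<parallel>\<^sub>2\<close> in the weak topology.\<close>

lemma nearest_point:
  assumes x: "x \<in> M"
  shows "\<exists>y\<in>N. norm y \<le> 1 \<and> (\<forall>z\<in>N. norm z \<le> 1 \<longrightarrow> norm2 \<tau> (x - y) \<le> norm2 \<tau> (x - z))"
proof -
  define C where "C = {z \<in> N. norm z \<le> 1}"
  define d where "d = (INF z\<in>C. norm2 \<tau> (x - z))"
  have C_M: "z \<in> M" if "z \<in> C" for z using that sub by (simp add: C_def)
  have "0 \<in> C" by (simp add: C_def N_mem)
  have bdd: "bdd_below ((\<lambda>z. norm2 \<tau> (x - z)) ` C)"
    by (rule bdd_belowI2[of _ 0]) (simp add: norm2_nonneg mem x C_M)
  have d_le: "d \<le> norm2 \<tau> (x - z)" if "z \<in> C" for z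
    unfolding d_def by (rule cINF_lower[OF bdd that])
  have "\<exists>z\<in>C. norm2 \<tau> (x - z) < d + inverse (real (Suc n))" for n
    using cInf_lessD[of "(\<lambda>z. norm2 \<tau> (x - z)) ` C" "d + inverse (real (Suc n))"] \<open>0 \<in> C\<close>
    by (force simp: d_def)
  then obtain y where y: "\<And>n. y n \<in> C" "\<And>n. norm2 \<tau> (x - y n) < d + inverse (real (Suc n))"
    by metis
  have yN: "y n \<in> N" "norm (y n) \<le> 1" for n using y(1)[of n] by (simp_all add: C_def)
  obtain F T where F: "F \<noteq> bot" "F \<le> sequentially" and T: "T \<in> bounded_ops" "norm T \<le> 1"
    and lim: "\<And>\<xi> \<eta>. ((\<lambda>n. cinner (blinfun_apply (y n) \<xi>) \<eta>) \<longlongrightarrow> cinner (blinfun_apply T \<xi>) \<eta>) F"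
    using weak_cluster_point[of y] yN N.bounded by metis
  have TN: "T \<in> N"
    by (rule von_neumann_algebra_weakly_closed[OF N_vN yN(1) F(1) T(1) lim])
  have TM: "T \<in> M" and yM: "y n \<in> M" for n using TN yN sub by auto
  let ?u = "x - T"
  have uM: "?u \<in> M" using x TM by (rule diff_mem)
  have "((\<lambda>n. \<tau> (adj ?u o\<^sub>L y n)) \<longlongrightarrow> \<tau> (adj ?u o\<^sub>L T)) F"
    by (rule normal_functional_weak_limit[OF normal_functional_translate[OF normal star adj_mem[OF uM]]
        yM yN(2) TM F(1) lim])
  then have "((\<lambda>n. Re (\<tau> (adj ?u o\<^sub>L x) - \<tau> (adj ?u o\<^sub>L y n)))
      \<longlongrightarrow> Re (\<tau> (adj ?u o\<^sub>L x) - \<tau> (adj ?u o\<^sub>L T))) F"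
    by (intro tendsto_intros)
  then have lim_u: "((\<lambda>n. Re (\<tau> (adj ?u o\<^sub>L (x - y n)))) \<longlongrightarrow> (norm2 \<tau> ?u)\<^sup>2) F"
    by (simp add: blinfun_compose_diff_right tau_diff mem uM x TM yM norm2_square)
  have "(\<lambda>n. norm2 \<tau> ?u * (d + inverse (real (Suc n)))) \<longlonglongrightarrow> norm2 \<tau> ?u * (d + 0)"
    by (intro tendsto_intros LIMSEQ_inverse_real_of_nat)
  then have lim_d: "((\<lambda>n. norm2 \<tau> ?u * (d + inverse (real (Suc n)))) \<longlongrightarrow> norm2 \<tau> ?u * (d + 0)) F"
    by (rule tendsto_mono[OF F(2)])
  have "Re (\<tau> (adj ?u o\<^sub>L (x - y n))) \<le> norm2 \<tau> ?u * (d + inverse (real (Suc n)))" for n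
    using Re_tau_adj_mult_le[OF uM, of "x - y n"] y(2)[of n]
      mult_left_mono[of "norm2 \<tau> (x - y n)" "d + inverse (real (Suc n))" "norm2 \<tau> ?u"]
    by (simp add: mem x yM norm2_nonneg uM)
  then have "(norm2 \<tau> ?u)\<^sup>2 \<le> norm2 \<tau> ?u * (d + 0)"
    by (intro tendsto_le[OF F(1) lim_d lim_u]) simp
  then have "norm2 \<tau> ?u \<le> d"
  proof (cases "norm2 \<tau> ?u = 0")
    case True
    have "0 \<le> d" unfolding d_def
      by (rule cINF_greatest) (use \<open>0 \<in> C\<close> in \<open>auto simp: norm2_nonneg mem x C_M\<close>)
    with True show ?thesis by simp
  next
    case False
    then have "0 < norm2 \<tau> ?u" using norm2_nonneg[OF uM] by linarith
    moreover assume "(norm2 \<tau> ?u)\<^sup>2 \<le> norm2 \<tau> ?u * (d + 0)"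
    ultimately show ?thesis by (simp add: power2_eq_square)
  qed
  then show ?thesis
    using TN T(2) d_le by (intro bexI[of _ T]) (auto simp: C_def intro: order.trans)
qed

lemma variational_inequality:
  assumes u: "u \<in> M" and v: "v \<in> M" and t0: "0 < t0"
    and min: "\<And>t. 0 \<le> t \<Longrightarrow> t \<le> t0 \<Longrightarrow> norm2 \<tau> u \<le> norm2 \<tau> (u - t *\<^sub>R v)"
  shows "Re (\<tau> (adj u o\<^sub>L v)) \<le> 0"
proof (rule ccontr)
  define r where "r = Re (\<tau> (adj u o\<^sub>L v))"
  define V where "V = (norm2 \<tau> v)\<^sup>2"
  assume "\<not> Re (\<tau> (adj u o\<^sub>L v)) \<le> 0"
  then have r: "0 < r" by (simp add: r_def)
  have V: "0 \<le> V" by (simp add: V_def)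
  \<comment> \<open>so small that the quadratic term \<open>t\<^sup>2 V\<close> cannot make up for the linear gain \<open>2 t r\<close>\<close>
  define t where "t = min t0 (r / (V + 1))"
  have t: "0 < t" "t \<le> t0" using t0 r V by (auto simp: t_def)
  have "t * V \<le> t * (V + 1)" using t by (intro mult_left_mono) auto
  also have "\<dots> \<le> r / (V + 1) * (V + 1)" using V by (intro mult_right_mono) (auto simp: t_def)
  finally have tV: "t * V \<le> r" using V by simp
  have "(norm2 \<tau> u)\<^sup>2 \<le> (norm2 \<tau> (u - t *\<^sub>R v))\<^sup>2"
    using min[of t] t norm2_nonneg[OF u] by (intro power_mono) auto
  also have "\<dots> = (norm2 \<tau> u)\<^sup>2 - 2 * (t * r) + t\<^sup>2 * V"
  proof -
    have eq: "u - t *\<^sub>R v = u + (- t) *\<^sub>R v" by simp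
    show ?thesis
      unfolding eq using norm2_add_square[OF u, of "(- t) *\<^sub>R v"] u v
      by (simp add: mem norm2_scaleR blinfun_compose_scaleR_right tau_scaleR r_def V_def
          power_mult_distrib del: scaleR_minus_left)
  qed
  finally have "t * (2 * r) \<le> t * (t * V)" by (simp add: power2_eq_square algebra_simps)
  then have "2 * r \<le> t * V" using t by simp
  with tV r show False by linarith
qed

text \<open>Let \<open>p = (y\<^sup>*y)\<^sup>m\<close>. Moving from \<open>y\<close> to \<open>y (1 - t p\<^sup>2)\<close> stays in the unit ball and cannot bring \<open>y\<close>
  closer to \<open>x\<close>, which says \<open>\<parallel>y p\<parallel>\<^sub>2\<^sup>2 \<le> Re \<langle>y p, x p\<rangle> \<le> \<parallel>y p\<parallel>\<^sub>2 \<parallel>x p\<parallel>\<^sub>2\<close>. Hence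
  \<open>\<parallel>y\<^sup>*y p\<parallel>\<^sub>2 \<le> \<parallel>y p\<parallel>\<^sub>2 \<le> c \<parallel>p\<parallel>\<^sub>2\<close>. In spectral terms, the mass of \<open>\<bar>y\<bar>\<close> at the boundary value \<open>1\<close> is zero.\<close>

lemma nearest_point_power_decay:
  assumes x: "x \<in> M" "norm x \<le> c" and c: "0 \<le> c" and y: "y \<in> N" "norm y \<le> 1"
    and min: "\<And>z. z \<in> N \<Longrightarrow> norm z \<le> 1 \<Longrightarrow> norm2 \<tau> (x - y) \<le> norm2 \<tau> (x - z)"
  shows "norm2 \<tau> (op_power (adj y o\<^sub>L y) m) \<le> c ^ m"
proof (induction m)
  case 0
  show ?case using tau_id by (simp add: norm2_def adj_id blinfun_compose_id)
next
  case (Suc m)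
  define h where "h = adj y o\<^sub>L y"
  define p where "p = op_power h m"
  have yM: "y \<in> M" using y sub by simp
  have yadj: "norm (adj y) \<le> 1" using y by (simp add: N.norm_adj)
  have h: "h \<in> N" "adj h = h" using y by (simp_all add: h_def N_mem N.adj_mult N.adj_adj)
  have "norm h \<le> norm (adj y) * norm y" unfolding h_def by (rule norm_blinfun_compose)
  also have "\<dots> \<le> 1 * 1" using y yadj by (intro mult_mono) auto
  finally have "norm h \<le> 1" by simp
  then have p: "p \<in> N" "adj p = p" "norm p \<le> 1"
    using h by (simp_all add: p_def N.op_power_mem N.adj_op_power norm_op_power_le)
  have pM: "p \<in> M" using p sub by simp
  have yp: "y o\<^sub>L p \<in> M" and xp: "x o\<^sub>L p \<in> M" using yM pM x by (auto simp: mem)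
  define v where "v = - (y o\<^sub>L (p o\<^sub>L p))"
  have vN: "v \<in> N" using y p by (simp add: v_def N_mem)
  have "Re (\<tau> (adj (x - y) o\<^sub>L v)) \<le> 0"
  proof (rule variational_inequality[of _ _ 1])
    fix t :: real assume t: "0 \<le> t" "t \<le> 1"
    have eq: "y + t *\<^sub>R v = y o\<^sub>L (id_blinfun - t *\<^sub>R (p o\<^sub>L p))"
      by (rule blinfun_eqI) (simp add: v_def blinfun.bilinear_simps)
    have "norm (y + t *\<^sub>R v) \<le> norm y * norm (id_blinfun - t *\<^sub>R (p o\<^sub>L p))"
      unfolding eq by (rule norm_blinfun_compose)
    also have "\<dots> \<le> 1 * 1"
      using y(2) norm_id_minus_square_le[OF N.bounded[OF p(1)] p(2,3) t] by (intro mult_mono) auto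
    finally have "norm2 \<tau> (x - y) \<le> norm2 \<tau> (x - (y + t *\<^sub>R v))"
      using y vN by (intro min) (auto simp: N_mem)
    then show "norm2 \<tau> (x - y) \<le> norm2 \<tau> (x - y - t *\<^sub>R v)" by (simp add: algebra_simps)
  qed (use x yM vN sub in \<open>auto simp: mem\<close>)
  moreover have "\<tau> (adj (x - y) o\<^sub>L v)
      = \<tau> (adj y o\<^sub>L (y o\<^sub>L (p o\<^sub>L p))) - \<tau> (adj x o\<^sub>L (y o\<^sub>L (p o\<^sub>L p)))"
  proof -
    have "adj (x - y) o\<^sub>L v = (adj y o\<^sub>L (y o\<^sub>L (p o\<^sub>L p))) - (adj x o\<^sub>L (y o\<^sub>L (p o\<^sub>L p)))"
      using x yM by (intro blinfun_eqI) (simp add: v_def adj_diff blinfun.bilinear_simps)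
    then show ?thesis using x yM pM by (simp add: tau_diff mem)
  qed
  moreover have cyc: "\<tau> (adj z o\<^sub>L (y o\<^sub>L (p o\<^sub>L p))) = \<tau> (adj (z o\<^sub>L p) o\<^sub>L (y o\<^sub>L p))" if "z \<in> M" for z
    using tau_commute[of "adj z o\<^sub>L (y o\<^sub>L p)" p] that yM pM p(2)
    by (simp add: mem adj_mult blinfun_compose_assoc)
  ultimately have "(norm2 \<tau> (y o\<^sub>L p))\<^sup>2 \<le> Re (\<tau> (adj (x o\<^sub>L p) o\<^sub>L (y o\<^sub>L p)))"
    using x yM by (simp add: norm2_square yp)
  also have "\<dots> \<le> norm2 \<tau> (x o\<^sub>L p) * norm2 \<tau> (y o\<^sub>L p)" by (rule Re_tau_adj_mult_le[OF xp yp])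
  finally have "norm2 \<tau> (y o\<^sub>L p) \<le> norm2 \<tau> (x o\<^sub>L p)"
    using norm2_nonneg[OF yp] norm2_nonneg[OF xp] by (cases "norm2 \<tau> (y o\<^sub>L p) = 0") (auto simp: power2_eq_square)
  also have "\<dots> \<le> c * norm2 \<tau> p" by (rule norm2_mult_le[OF x pM])
  also have "\<dots> \<le> c * c ^ m" using Suc c by (intro mult_left_mono) (simp_all add: p_def h_def)
  finally have yp_le: "norm2 \<tau> (y o\<^sub>L p) \<le> c * c ^ m" .
  have "norm2 \<tau> (adj y o\<^sub>L (y o\<^sub>L p)) \<le> norm2 \<tau> (y o\<^sub>L p)"
    by (rule norm2_contraction_le[OF adj_mem[OF yM] yadj yp])
  with yp_le show ?case by (simp add: p_def h_def blinfun_compose_assoc)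
qed

text \<open>Put \<open>h = y\<^sup>*y\<close> and \<open>k = yy\<^sup>*\<close>. Minimality along the admissible perturbations makes \<open>x - y\<close> orthogonal
  to \<open>(1 - k) b (1 - h)\<close> for all \<open>b \<in> N\<close>, in particular to \<open>(1 - k\<^sup>m) a (1 - h\<^sup>m)\<close>, and these
  converge to \<open>a\<close> in \<open>\<parallel>\<cdot>\<parallel>\<^sub>2\<close>. All inequalities concern real parts only; equality comes
  from replacing \<open>a\<close> by its complex multiples.\<close>

lemma nearest_point_orthogonal:
  assumes x: "x \<in> M" "norm x \<le> c" and c: "0 \<le> c" "c < 1" and y: "y \<in> N" "norm y \<le> 1"
    and min: "\<And>z. z \<in> N \<Longrightarrow> norm z \<le> 1 \<Longrightarrow> norm2 \<tau> (x - y) \<le> norm2 \<tau> (x - z)"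
    and a: "a \<in> N"
  shows "\<tau> (adj (x - y) o\<^sub>L a) = 0"
proof -
  define u where "u = x - y"
  define h where "h = adj y o\<^sub>L y"
  define k where "k = y o\<^sub>L adj y"
  have yM: "y \<in> M" using y sub by simp
  have uM: "u \<in> M" using x yM by (simp add: u_def mem)
  have hN: "h \<in> N" and kN: "k \<in> N" using y by (auto simp: h_def k_def N_mem)
  have defect: "Re (\<tau> (adj u o\<^sub>L ((id_blinfun - k) o\<^sub>L (b o\<^sub>L (id_blinfun - h))))) \<le> 0"
    if b: "b \<in> N" for b
  proof -
    \<comment> \<open>rescales \<open>b\<close> to a contraction\<close>
    define r where "r = 1 / (norm b + 1)"
    have pos: "0 < norm b + 1" by (simp add: add_nonneg_pos)
    then have r: "0 < r" by (simp add: r_def)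
    define v where "v = (id_blinfun - k) o\<^sub>L ((r *\<^sub>R b) o\<^sub>L (id_blinfun - h))"
    have nb: "norm (r *\<^sub>R b) \<le> 1"
      using pos by (simp add: r_def divide_le_eq)
    have vN: "v \<in> N" using b hN kN by (simp add: v_def N_mem)
    have "Re (\<tau> (adj u o\<^sub>L v)) \<le> 0"
    proof (rule variational_inequality[of _ _ "1/3"])
      fix t :: real assume t: "0 \<le> t" "t \<le> 1/3"
      have "norm (y + t *\<^sub>R v) \<le> 1"
        unfolding v_def h_def k_def
        by (rule norm_defect_perturbation_le[OF N.bounded[OF y(1)] y(2) nb t])
      then have "norm2 \<tau> (x - y) \<le> norm2 \<tau> (x - (y + t *\<^sub>R v))"
        using y vN by (intro min) (auto simp: N_mem)
      then show "norm2 \<tau> u \<le> norm2 \<tau> (u - t *\<^sub>R v)" by (simp add: u_def algebra_simps)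
    qed (use uM vN sub in auto)
    moreover have "adj u o\<^sub>L v
        = r *\<^sub>R (adj u o\<^sub>L ((id_blinfun - k) o\<^sub>L (b o\<^sub>L (id_blinfun - h))))"
      by (simp add: v_def blinfun_compose_scaleR_left blinfun_compose_scaleR_right)
    ultimately show ?thesis
      using r uM b hN kN sub by (simp add: tau_scaleR mem mult_le_0_iff)
  qed
  have Re_le: "Re (\<tau> (adj u o\<^sub>L a)) \<le> 0" if a: "a \<in> N" for a
  proof -
    have aM: "a \<in> M" using a sub by simp
    define p where "p m = op_power h (m::nat)" for m
    define q where "q m = op_power k (m::nat)" for m
    have pM: "p m \<in> M" and qM: "q m \<in> M" for m
      using hN kN sub N.op_power_mem by (auto simp: p_def q_def)
    have p_le: "norm2 \<tau> (p m) \<le> c ^ m" for m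
      unfolding p_def h_def by (rule nearest_point_power_decay[OF x c(1) y min])
    have q_le: "norm2 \<tau> (q (Suc m)) \<le> c ^ m" for m
    proof -
      have "norm2 \<tau> (q (Suc m)) = norm2 \<tau> (y o\<^sub>L (p m o\<^sub>L adj y))"
        unfolding q_def p_def k_def h_def by (simp only: op_power_swap)
      also have "\<dots> \<le> norm2 \<tau> (p m o\<^sub>L adj y)"
        using y yM pM by (intro norm2_contraction_le) (auto simp: mem)
      also have "\<dots> \<le> 1 * norm2 \<tau> (p m)"
        using y yM pM by (intro norm2_mult_le') (auto simp: mem norm_adj)
      finally show ?thesis using p_le[of m] by simp
    qed
    have k1: "norm k \<le> 1"
    proof -
      have "norm k \<le> norm y * norm (adj y)" unfolding k_def by (rule norm_blinfun_compose)
      also have "\<dots> \<le> 1 * 1" using y by (intro mult_mono) (auto simp: N.norm_adj)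
      finally show ?thesis by simp
    qed
    have bound: "Re (\<tau> (adj u o\<^sub>L a)) \<le> norm2 \<tau> u * (norm a * c ^ m + 2 * norm a * c ^ Suc m)" for m
    proof -
      \<comment> \<open>\<open>a = b + (w1 + w2)\<close> with \<open>b\<close> in the range of admissible perturbations and \<open>w1\<close>, \<open>w2\<close> small\<close>
      define w1 where "w1 = q (Suc m) o\<^sub>L a"
      define w2 where "w2 = ((id_blinfun - q (Suc m)) o\<^sub>L a) o\<^sub>L p (Suc m)"
      define b where "b = (id_blinfun - q (Suc m)) o\<^sub>L (a o\<^sub>L (id_blinfun - p (Suc m)))"
      have wM: "w1 \<in> M" "w2 \<in> M" "b \<in> M"
        unfolding w1_def w2_def b_def by (intro mem aM pM qM)+
      have a_eq: "a = b + (w1 + w2)"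
        by (rule blinfun_eqI) (simp add: b_def w1_def w2_def blinfun.bilinear_simps)
      obtain s where s: "s \<in> N" "id_blinfun - p (Suc m) = s o\<^sub>L (id_blinfun - h)"
        using N.id_minus_op_power_factor[OF hN] unfolding p_def by blast
      obtain s' where s': "s' \<in> N" "id_blinfun - q (Suc m) = (id_blinfun - k) o\<^sub>L s'"
        using N.id_minus_op_power_factor[OF kN] unfolding q_def by blast
      have "b = (id_blinfun - k) o\<^sub>L ((s' o\<^sub>L (a o\<^sub>L s)) o\<^sub>L (id_blinfun - h))"
        unfolding b_def s(2) s'(2) by (simp only: blinfun_compose_assoc)
      then have b_le: "Re (\<tau> (adj u o\<^sub>L b)) \<le> 0"
        using defect[of "s' o\<^sub>L (a o\<^sub>L s)"] a s(1) s'(1) by (simp add: N_mem)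
      have "norm2 \<tau> w1 \<le> norm a * c ^ m"
        using norm2_mult_le'[OF qM[of "Suc m"] aM order.refl] mult_left_mono[OF q_le[of m] norm_ge_zero[of a]]
        unfolding w1_def by linarith
      moreover have "norm2 \<tau> w2 \<le> 2 * norm a * c ^ Suc m"
      proof -
        have "norm (id_blinfun - q (Suc m)) \<le> 1 + 1"
          unfolding q_def using norm_op_power_le[OF k1, of "Suc m"]
          by (intro order.trans[OF norm_triangle_ineq4] add_mono norm_blinfun_id_le)
        then have "norm ((id_blinfun - q (Suc m)) o\<^sub>L a) \<le> 2 * norm a"
          by (intro order.trans[OF norm_blinfun_compose] mult_right_mono) auto
        then have "norm2 \<tau> w2 \<le> 2 * norm a * norm2 \<tau> (p (Suc m))"
          unfolding w2_def by (intro norm2_mult_le pM mem aM qM)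
        also have "\<dots> \<le> 2 * norm a * c ^ Suc m" by (intro mult_left_mono p_le) simp
        finally show ?thesis .
      qed
      ultimately have "norm2 \<tau> (w1 + w2) \<le> norm a * c ^ m + 2 * norm a * c ^ Suc m"
        using norm2_triangle[OF wM(1,2)] by linarith
      then have "norm2 \<tau> u * norm2 \<tau> (w1 + w2) \<le> norm2 \<tau> u * (norm a * c ^ m + 2 * norm a * c ^ Suc m)"
        by (intro mult_left_mono norm2_nonneg uM)
      moreover have "Re (\<tau> (adj u o\<^sub>L (w1 + w2))) \<le> norm2 \<tau> u * norm2 \<tau> (w1 + w2)"
        by (intro Re_tau_adj_mult_le uM add_mem wM)
      moreover have "\<tau> (adj u o\<^sub>L a) = \<tau> (adj u o\<^sub>L b) + \<tau> (adj u o\<^sub>L (w1 + w2))"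
        using uM wM by (subst a_eq) (simp only: blinfun_compose_add_right tau_add mem)
      ultimately show ?thesis using b_le by simp
    qed
    have pow: "(\<lambda>m. c ^ m) \<longlonglongrightarrow> 0" using c by (intro LIMSEQ_power_zero) simp
    have "(\<lambda>m. norm2 \<tau> u * (norm a * c ^ m + 2 * norm a * c ^ Suc m))
        \<longlonglongrightarrow> norm2 \<tau> u * (norm a * 0 + 2 * norm a * 0)"
      by (intro tendsto_intros pow LIMSEQ_Suc[OF pow])
    then show ?thesis using bound by (intro LIMSEQ_le_const) auto
  qed
  have "\<tau> (adj u o\<^sub>L a) = 0"
  proof (rule complex_eqI_Re)
    fix z :: complex
    have "Re (z * \<tau> (adj u o\<^sub>L a)) \<le> 0" for z
    proof -
      have "adj u o\<^sub>L scaleC_op z a = scaleC_op z (adj u o\<^sub>L a)"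
        by (rule blinfun_eqI) (simp add: bounded_opsD[OF bounded] mem uM)
      then show ?thesis
        using Re_le[of "scaleC_op z a"] a uM sub by (simp add: N_mem tau_scale mem)
    qed
    from this[of z] this[of "- z"] show "Re (z * \<tau> (adj u o\<^sub>L a)) = Re (z * 0)" by simp
  qed
  then show ?thesis by (simp add: u_def)
qed

lemma trace_representative_unique:
  assumes "e \<in> N" "e' \<in> N" and "\<And>a. a \<in> N \<Longrightarrow> \<tau> (a o\<^sub>L e) = \<tau> (a o\<^sub>L e')"
  shows "e = e'"
proof -
  have d: "e - e' \<in> N" using assms by (simp add: N_mem)
  then have "\<tau> (adj (e - e') o\<^sub>L (e - e')) = 0"
    using assms sub by (simp add: blinfun_compose_diff_right tau_diff N_mem)
  with d sub have "e - e' = 0" by (intro tau_faithful) auto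
  then show ?thesis by simp
qed

lemma contraction_trace_representative:
  assumes x: "x \<in> M" "norm x \<le> c" and c: "0 \<le> c" "c < 1"
  shows "\<exists>e\<in>N. norm e \<le> 1 \<and> (\<forall>a\<in>N. \<tau> (a o\<^sub>L e) = \<tau> (a o\<^sub>L x))"
proof -
  obtain y where y: "y \<in> N" "norm y \<le> 1"
    and min: "\<And>z. z \<in> N \<Longrightarrow> norm z \<le> 1 \<Longrightarrow> norm2 \<tau> (x - y) \<le> norm2 \<tau> (x - z)"
    using nearest_point[OF x(1)] by blast
  have yM: "y \<in> M" using y sub by simp
  have "\<tau> (a o\<^sub>L y) = \<tau> (a o\<^sub>L x)" if a: "a \<in> N" for a
  proof -
    have aM: "a \<in> M" using a sub by simp
    have "\<tau> (adj (x - y) o\<^sub>L adj a) = 0"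
      by (rule nearest_point_orthogonal[OF x c y min N.adj_mem[OF a]])
    then have "\<tau> (adj (a o\<^sub>L (x - y))) = 0"
      using aM x yM by (simp add: adj_mult mem)
    then have "\<tau> (a o\<^sub>L (x - y)) = 0"
      using tau_adj[of "a o\<^sub>L (x - y)"] aM x yM by (simp add: mem)
    then show ?thesis using aM x yM by (simp add: blinfun_compose_diff_right tau_diff mem)
  qed
  with y show ?thesis by blast
qed

text \<open>Scaling \<open>x\<close> below norm one costs an arbitrarily small factor in the bound for \<open>e\<close>;
  since \<open>e\<close> is unique, all these bounds hold for the same element.\<close>

lemma trace_representative:
  assumes x: "x \<in> M"
  shows "\<exists>e\<in>N. norm e \<le> norm x \<and> (\<forall>a\<in>N. \<tau> (a o\<^sub>L e) = \<tau> (a o\<^sub>L x))"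
proof (cases "x = 0")
  case True
  then show ?thesis by (intro bexI[of _ 0]) (auto simp: N_mem)
next
  case False
  have ex: "\<exists>e\<in>N. norm e \<le> r \<and> (\<forall>a\<in>N. \<tau> (a o\<^sub>L e) = \<tau> (a o\<^sub>L x))" if r: "norm x < r" for r
  proof -
    have r0: "0 < r" using r norm_ge_zero[of x] by linarith
    have "(1 / r) *\<^sub>R x \<in> M" using x by (simp add: mem)
    moreover have "norm ((1 / r) *\<^sub>R x) \<le> norm x / r" using r0 by simp
    moreover have "0 \<le> norm x / r" "norm x / r < 1" using r r0 by simp_all
    ultimately obtain e where e: "e \<in> N" "norm e \<le> 1"
      "\<And>a. a \<in> N \<Longrightarrow> \<tau> (a o\<^sub>L e) = \<tau> (a o\<^sub>L ((1 / r) *\<^sub>R x))"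
      using contraction_trace_representative by blast
    show ?thesis
    proof (intro bexI conjI ballI)
      show "norm (r *\<^sub>R e) \<le> r" using e(2) r0 by simp
      show "\<tau> (a o\<^sub>L (r *\<^sub>R e)) = \<tau> (a o\<^sub>L x)" if "a \<in> N" for a
        using e(1) e(3)[OF that] r0 x sub that
        by (simp add: blinfun_compose_scaleR_right tau_scaleR mem)
    qed (use e(1) in \<open>simp add: N_mem\<close>)
  qed
  obtain e where e: "e \<in> N" "\<forall>a\<in>N. \<tau> (a o\<^sub>L e) = \<tau> (a o\<^sub>L x)"
    using ex[of "norm x + 1"] by auto
  have "norm e \<le> r" if r: "norm x < r" for r
  proof -
    obtain e' where e': "e' \<in> N" "norm e' \<le> r" "\<forall>a\<in>N. \<tau> (a o\<^sub>L e') = \<tau> (a o\<^sub>L x)"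
      using ex[OF r] by blast
    have "e = e'" by (rule trace_representative_unique) (use e e' in simp_all)
    with e' show ?thesis by simp
  qed
  then have "norm e \<le> norm x" by (rule dense_ge)
  with e show ?thesis by blast
qed

definition E :: "('h \<Rightarrow>\<^sub>L 'h) \<Rightarrow> 'h \<Rightarrow>\<^sub>L 'h"
  where "E x = (SOME e. e \<in> N \<and> norm e \<le> norm x \<and> (\<forall>a\<in>N. \<tau> (a o\<^sub>L e) = \<tau> (a o\<^sub>L x)))"

lemma E:
  assumes "x \<in> M"
  shows E_mem: "E x \<in> N" and norm_E_le: "norm (E x) \<le> norm x"
    and tau_mult_E: "a \<in> N \<Longrightarrow> \<tau> (a o\<^sub>L E x) = \<tau> (a o\<^sub>L x)"
proof -
  have "E x \<in> N \<and> norm (E x) \<le> norm x \<and> (\<forall>a\<in>N. \<tau> (a o\<^sub>L E x) = \<tau> (a o\<^sub>L x))"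
    unfolding E_def by (rule someI_ex) (use trace_representative[OF assms] in blast)
  then show "E x \<in> N" "norm (E x) \<le> norm x" "a \<in> N \<Longrightarrow> \<tau> (a o\<^sub>L E x) = \<tau> (a o\<^sub>L x)" by auto
qed

lemma E_eqI:
  assumes "x \<in> M" "e \<in> N" "\<And>a. a \<in> N \<Longrightarrow> \<tau> (a o\<^sub>L e) = \<tau> (a o\<^sub>L x)"
  shows "E x = e"
  by (rule trace_representative_unique) (simp_all add: assms E_mem tau_mult_E)

lemma E_add:
  assumes "x \<in> M" "y \<in> M" shows "E (x + y) = E x + E y"
proof (rule E_eqI)
  show "\<tau> (a o\<^sub>L (E x + E y)) = \<tau> (a o\<^sub>L (x + y))" if "a \<in> N" for a
    using assms that sub E_mem
    by (simp add: blinfun_compose_add_right tau_add mem tau_mult_E)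
qed (use assms E_mem in \<open>simp_all add: mem N_mem\<close>)

lemma E_scale:
  assumes "x \<in> M" shows "E (scaleC_op c x) = scaleC_op c (E x)"
proof (rule E_eqI)
  show "\<tau> (a o\<^sub>L scaleC_op c (E x)) = \<tau> (a o\<^sub>L scaleC_op c x)" if a: "a \<in> N" for a
  proof -
    have "a o\<^sub>L scaleC_op c z = scaleC_op c (a o\<^sub>L z)" for z
      by (rule blinfun_eqI) (simp add: bounded_opsD[OF N.bounded[OF a]])
    then show ?thesis
      using assms a sub E_mem by (simp add: tau_scale mem tau_mult_E)
  qed
qed (use assms E_mem in \<open>simp_all add: mem N_mem\<close>)

lemma E_adj:
  assumes "x \<in> M" shows "E (adj x) = adj (E x)"
proof (rule E_eqI)
  fix a assume a: "a \<in> N"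
  have aM: "a \<in> M" and Ex: "E x \<in> M" using a assms sub E_mem by auto
  have swap: "\<tau> (a o\<^sub>L adj z) = cnj (\<tau> (adj a o\<^sub>L z))" if z: "z \<in> M" for z
  proof -
    have "cnj (\<tau> (adj a o\<^sub>L z)) = \<tau> (adj z o\<^sub>L a)"
      using tau_adj[of "adj a o\<^sub>L z"] aM z by (simp add: mem adj_mult adj_adj)
    also have "\<dots> = \<tau> (a o\<^sub>L adj z)" using aM z by (intro tau_commute) (simp_all add: mem)
    finally show ?thesis by simp
  qed
  show "\<tau> (a o\<^sub>L adj (E x)) = \<tau> (a o\<^sub>L adj x)"
    using assms a Ex by (simp add: swap tau_mult_E N_mem)
qed (use assms E_mem in \<open>simp_all add: mem N_mem\<close>)

lemma E_id_on: "y \<in> N \<Longrightarrow> E y = y"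
  by (rule E_eqI) (simp_all add: sub)

lemma E_bimodule:
  assumes "x \<in> M" "a \<in> N" "b \<in> N"
  shows "E (a o\<^sub>L x o\<^sub>L b) = a o\<^sub>L E x o\<^sub>L b"
proof (rule E_eqI)
  have aM: "a \<in> M" and bM: "b \<in> M" and Ex: "E x \<in> M" using assms sub E_mem by auto
  fix c assume c: "c \<in> N"
  then have cM: "c \<in> M" by (rule sub)
  have cyc: "\<tau> (c o\<^sub>L (a o\<^sub>L z o\<^sub>L b)) = \<tau> ((b o\<^sub>L (c o\<^sub>L a)) o\<^sub>L z)" if "z \<in> M" for z
    using tau_commute[of "c o\<^sub>L (a o\<^sub>L z)" b] aM bM cM that
    by (simp add: mem blinfun_compose_assoc)
  show "\<tau> (c o\<^sub>L (a o\<^sub>L E x o\<^sub>L b)) = \<tau> (c o\<^sub>L (a o\<^sub>L x o\<^sub>L b))"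
    unfolding cyc[OF Ex] cyc[OF assms(1)] using assms c by (intro tau_mult_E) (simp_all add: N_mem)
next
  show "a o\<^sub>L x o\<^sub>L b \<in> M" using assms sub by (simp add: mem)
  show "a o\<^sub>L E x o\<^sub>L b \<in> N" using assms by (simp add: N_mem E_mem)
qed

lemma tau_E: "x \<in> M \<Longrightarrow> \<tau> (E x) = \<tau> x"
  using tau_mult_E[of x id_blinfun] by (simp add: N_mem blinfun_compose_id)

text \<open>A self-adjoint \<open>e\<close> is positive once \<open>\<parallel>s 1 - e\<parallel> \<le> s\<close> for some \<open>s\<close>, and this bound is transported from
  \<open>x\<close> to \<open>E x\<close> because \<open>E\<close> is unital and contractive.\<close>

lemma E_positive:
  assumes x: "x \<in> M" and pos: "positive_op x" shows "positive_op (E x)"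
proof -
  define s where "s = norm x + 1"
  have s: "0 < s" "norm x \<le> s" by (simp_all add: s_def add_nonneg_pos)
  have x_sa: "adj x = x" by (rule positive_op_selfadjoint[OF pos])
  have Esa: "adj (E x) = E x" using E_adj[OF x] x_sa by simp
  have Eb: "E x \<in> bounded_ops" using E_mem[OF x] N.bounded by simp
  have "norm (s *\<^sub>R id_blinfun - x) \<le> s"
    by (rule norm_minus_positive_le[OF pos s(2,1)])
  moreover have "E (s *\<^sub>R id_blinfun - x) = s *\<^sub>R id_blinfun - E x"
  proof (rule E_eqI)
    show "\<tau> (a o\<^sub>L (s *\<^sub>R id_blinfun - E x)) = \<tau> (a o\<^sub>L (s *\<^sub>R id_blinfun - x))" if "a \<in> N" for a
      using that x sub E_mem by (simp add: blinfun_compose_diff_right tau_diff mem tau_mult_E)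
  qed (use x E_mem in \<open>simp_all add: mem N_mem\<close>)
  moreover have "s *\<^sub>R id_blinfun - x \<in> M" using x by (simp add: mem)
  ultimately have le: "norm (s *\<^sub>R id_blinfun - E x) \<le> s"
    using norm_E_le[of "s *\<^sub>R id_blinfun - x"] by simp
  show ?thesis
    unfolding positive_op_def
  proof (intro conjI allI Eb)
    fix \<xi>
    have "cnj (cinner (blinfun_apply (E x) \<xi>) \<xi>) = cinner (blinfun_apply (E x) \<xi>) \<xi>"
      by (metis Eb Esa cinner_adj_right cinner_commute)
    then have im: "Im (cinner (blinfun_apply (E x) \<xi>) \<xi>) = 0" by (simp add: complex_eq_iff)
    have "s * (norm \<xi>)\<^sup>2 - Re (cinner (blinfun_apply (E x) \<xi>) \<xi>)
        = Re (cinner (blinfun_apply (s *\<^sub>R id_blinfun - E x) \<xi>) \<xi>)"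
      by (simp add: blinfun.diff_left blinfun.scaleR_left cinner_simps cinner_self)
    also have "\<dots> \<le> cmod (cinner (blinfun_apply (s *\<^sub>R id_blinfun - E x) \<xi>) \<xi>)"
      by (rule complex_Re_le_cmod)
    also have "\<dots> \<le> norm (s *\<^sub>R id_blinfun - E x) * (norm \<xi> * norm \<xi>)"
      by (rule cmod_cinner_blinfun_le)
    also have "\<dots> \<le> s * (norm \<xi>)\<^sup>2"
      unfolding power2_eq_square by (rule mult_right_mono[OF le]) simp
    finally show "cinner (blinfun_apply (E x) \<xi>) \<xi> \<in> \<real>\<^sub>\<ge>\<^sub>0"
      using im by (simp add: complex_nonneg_Reals_iff)
  qed
qed

theorem trace_preserving_expectation_E: "trace_preserving_expectation M \<tau> N E"
  unfolding trace_preserving_expectation_def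
  using E_mem E_add E_scale E_positive E_id_on E_bimodule tau_E by blast

lemma cond_expectation: "trace_preserving_expectation M \<tau> N (cond_expectation M \<tau> N)"
  unfolding cond_expectation_def by (rule someI[of "trace_preserving_expectation M \<tau> N", OF trace_preserving_expectation_E])

lemma cond_expectation_mem: "x \<in> M \<Longrightarrow> cond_expectation M \<tau> N x \<in> N"
  and cond_expectation_id_on: "y \<in> N \<Longrightarrow> cond_expectation M \<tau> N y = y"
  using cond_expectation by (auto simp: trace_preserving_expectation_def)

end

section \<open>Points of the space of subalgebras are closed\<close>

context tracial
begin

lemma Metric_space_norm2:
  "Metric_space M (\<lambda>x y. if x \<in> M \<and> y \<in> M then norm2 \<tau> (x - y) else 0)"
proof
  fix x y z
  show "0 \<le> (if x \<in> M \<and> y \<in> M then norm2 \<tau> (x - y) else 0)"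
    by (simp add: norm2_nonneg mem)
  show "(if x \<in> M \<and> y \<in> M then norm2 \<tau> (x - y) else 0)
      = (if y \<in> M \<and> x \<in> M then norm2 \<tau> (y - x) else 0)"
    using norm2_uminus[of "x - y"] by (simp add: mem)
  assume x: "x \<in> M" and y: "y \<in> M"
  show "(if x \<in> M \<and> y \<in> M then norm2 \<tau> (x - y) else 0) = 0 \<longleftrightarrow> x = y"
    using x y norm2_eq_0[of "x - y"] norm2_scaleR[of 0 0] by (auto simp: mem)
  assume z: "z \<in> M"
  show "(if x \<in> M \<and> z \<in> M then norm2 \<tau> (x - z) else 0)
      \<le> (if x \<in> M \<and> y \<in> M then norm2 \<tau> (x - y) else 0)
        + (if y \<in> M \<and> z \<in> M then norm2 \<tau> (y - z) else 0)"
    using norm2_triangle[of "x - y" "y - z"] x y z by (simp add: mem)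
qed

lemma openin_L2_topology_Diff_singleton:
  assumes "e \<in> M" shows "openin (L2_topology M \<tau>) (M - {e})"
proof -
  interpret Metric_space M "\<lambda>x y. if x \<in> M \<and> y \<in> M then norm2 \<tau> (x - y) else 0"
    by (rule Metric_space_norm2)
  have "closedin mtopology {e}"
    using assms by (intro closedin_Hausdorff_singleton[OF Hausdorff_space_mtopology]) simp
  then show ?thesis
    unfolding L2_topology_def using openin_diff[OF openin_topspace[of mtopology]] by simp
qed

text \<open>The union of the generating sets is all of \<open>Sub M\<close> since it contains the set given by \<open>x = 0\<close>
  and \<open>W = M\<close>.\<close>

lemma topspace_effros_marechal: "topspace (effros_marechal_topology M \<tau>) = Sub M"
proof -
  have sub: "tracial_subalgebra M \<tau> N" if "N \<in> Sub M" for N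
    using that by (simp add: tracial_subalgebra_def tracial_axioms tracial_subalgebra_axioms_def)
  interpret Metric_space M "\<lambda>x y. if x \<in> M \<and> y \<in> M then norm2 \<tau> (x - y) else 0"
    by (rule Metric_space_norm2)
  have "openin (L2_topology M \<tau>) M"
    unfolding L2_topology_def using openin_topspace[of mtopology] by simp
  moreover have "{N \<in> Sub M. cond_expectation M \<tau> N 0 \<in> M} = Sub M"
    using tracial_subalgebra.cond_expectation_mem[OF sub] tracial_subalgebra.sub[OF sub] zero_mem
    by blast
  ultimately have "Sub M \<in> {{N \<in> Sub M. cond_expectation M \<tau> N x \<in> W} | x W.
      x \<in> M \<and> openin (L2_topology M \<tau>) W}"
    using zero_mem by blast
  then show ?thesis
    unfolding effros_marechal_topology_def topology_generated_by_topspace by auto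
qed

text \<open>If \<open>y\<close> lies in exactly one of \<open>N\<close>, \<open>N'\<close>, then one of the expectations fixes \<open>y\<close> while the other maps it
  to a different element.\<close>

lemma closedin_effros_marechal_singleton:
  assumes N: "N \<in> Sub M" shows "closedin (effros_marechal_topology M \<tau>) {N}"
proof -
  let ?T = "effros_marechal_topology M \<tau>"
  interpret N: tracial_subalgebra M \<tau> N by unfold_locales (rule N)
  have "\<exists>V. openin ?T V \<and> N' \<in> V \<and> V \<subseteq> Sub M - {N}" if N': "N' \<in> Sub M - {N}" for N'
  proof -
    interpret N': tracial_subalgebra M \<tau> N' using N' by unfold_locales auto
    have "\<exists>x\<in>M. cond_expectation M \<tau> N' x \<noteq> cond_expectation M \<tau> N x"
    proof (cases "N \<subseteq> N'")
      case True
      with N' obtain y where y: "y \<in> N'" "y \<notin> N" by blast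
      then have "cond_expectation M \<tau> N' y \<noteq> cond_expectation M \<tau> N y"
        using N.cond_expectation_mem[of y] N'.cond_expectation_id_on[of y] N'.sub by auto
      with y N'.sub show ?thesis by blast
    next
      case False
      then obtain y where y: "y \<in> N" "y \<notin> N'" by blast
      then have "cond_expectation M \<tau> N' y \<noteq> cond_expectation M \<tau> N y"
        using N'.cond_expectation_mem[of y] N.cond_expectation_id_on[of y] N.sub by auto
      with y N.sub show ?thesis by blast
    qed
    then obtain x where x: "x \<in> M" "cond_expectation M \<tau> N' x \<noteq> cond_expectation M \<tau> N x" by blast
    define W where "W = M - {cond_expectation M \<tau> N x}"
    have "openin (L2_topology M \<tau>) W"
      unfolding W_def using N.cond_expectation_mem[OF x(1)] N.sub
      by (intro openin_L2_topology_Diff_singleton) simp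
    then have "openin ?T {L \<in> Sub M. cond_expectation M \<tau> L x \<in> W}"
      unfolding effros_marechal_topology_def using x(1)
      by (intro topology_generated_by_Basis) blast
    moreover have "N' \<in> {L \<in> Sub M. cond_expectation M \<tau> L x \<in> W}"
      using N' x N'.cond_expectation_mem[OF x(1)] N'.sub by (auto simp: W_def)
    moreover have "{L \<in> Sub M. cond_expectation M \<tau> L x \<in> W} \<subseteq> Sub M - {N}"
      by (auto simp: W_def)
    ultimately show ?thesis by blast
  qed
  then have "openin ?T (Sub M - {N})" by (subst openin_subopen) blast
  then show ?thesis using N by (simp add: closedin_def topspace_effros_marechal)
qed

end

section \<open>Orbits\<close>

text \<open>The restriction makes the maps on \<open>Pow M\<close> extensional, as membership in \<^const>\<open>BijGroup\<close> demands.\<close>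

lemma sub_action_group_action:
  fixes G (structure)
  assumes "group_action G M \<alpha>"
  shows "group_action G (Pow M) (\<lambda>g. restrict (sub_action \<alpha> g) (Pow M))"
proof -
  interpret group_action G M \<alpha> by (rule assms)
  interpret G: group G using group_hom group_hom.axioms(1) by blast
  have Bij: "restrict (sub_action \<alpha> g) (Pow M) \<in> Bij (Pow M)" if g: "g \<in> carrier G" for g
    using bij_betw_Pow[of "\<alpha> g" M M] bij_prop0[OF g] by (simp add: Bij_def)
  show ?thesis
    unfolding group_action_def
  proof (intro group_hom.intro group_hom_axioms.intro homI)
    show "group G" "group (BijGroup (Pow M))" by (rule G.is_group, rule group_BijGroup)
    show "restrict (sub_action \<alpha> g) (Pow M) \<in> carrier (BijGroup (Pow M))" if "g \<in> carrier G" for g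
      using Bij[OF that] by (simp add: BijGroup_def)
    fix g h assume g: "g \<in> carrier G" and h: "h \<in> carrier G"
    show "restrict (sub_action \<alpha> (g \<otimes> h)) (Pow M) =
        restrict (sub_action \<alpha> g) (Pow M) \<otimes>\<^bsub>BijGroup (Pow M)\<^esub> restrict (sub_action \<alpha> h) (Pow M)"
    proof
      fix N
      have "\<alpha> (g \<otimes> h) ` N = \<alpha> g ` \<alpha> h ` N" if "N \<subseteq> M"
        using composition_rule[OF _ g h] that by (auto simp: image_image intro!: image_cong)
      moreover have "\<alpha> h ` N \<subseteq> M" if "N \<subseteq> M" using surj_prop[OF h] that by blast
      ultimately show "restrict (sub_action \<alpha> (g \<otimes> h)) (Pow M) N =
          (restrict (sub_action \<alpha> g) (Pow M) \<otimes>\<^bsub>BijGroup (Pow M)\<^esub> restrict (sub_action \<alpha> h) (Pow M)) N"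
        using Bij[OF g] Bij[OF h] by (simp add: BijGroup_def compose_def)
    qed
  qed
qed

lemma subgroup_index_stabilizer:
  assumes act: "group_action G X \<phi>" and x: "x \<in> X"
  shows "subgroup_index G (stabilizer G \<phi> x) =
    (if finite (orbit G \<phi> x) then enat (card (orbit G \<phi> x)) else \<infinity>)"
proof -
  interpret group_action G X \<phi> by (rule act)
  note bij = orbit_stab_fun_is_bij[OF x]
  show ?thesis
    unfolding subgroup_index_def using bij_betw_finite[OF bij] bij_betw_same_card[OF bij] by simp
qed

text \<open>A finite orbit is a finite union of closed points, hence closed, and minimality makes it all of
  \<open>U\<close>. So either all orbits are equal to \<open>U\<close>, or all are infinite.\<close>

lemma minimal_invariant_index_constant:
  fixes G (structure)
  assumes act: "group_action G X \<phi>" and U: "U \<subseteq> X"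
    and closed: "\<And>x. x \<in> U \<Longrightarrow> closedin T {x}"
    and inv: "\<And>g x. g \<in> carrier G \<Longrightarrow> x \<in> U \<Longrightarrow> \<phi> g x \<in> U"
    and min: "\<And>V. V \<subseteq> U \<Longrightarrow> V \<noteq> {} \<Longrightarrow> closedin T V \<Longrightarrow> invariant_subset G \<phi> V \<Longrightarrow> V = U"
    and x: "x \<in> U" and y: "y \<in> U"
  shows "subgroup_index G (stabilizer G \<phi> x) = subgroup_index G (stabilizer G \<phi> y)"
proof -
  interpret group_action G X \<phi> by (rule act)
  interpret G: group G using group_hom group_hom.axioms(1) by blast
  have orbit_sub: "orbit G \<phi> z \<subseteq> U" if "z \<in> U" for z
    using inv that by (auto simp: orbit_def)
  have orbit_eq: "orbit G \<phi> z = U" if z: "z \<in> U" and fin: "finite (orbit G \<phi> z)" for z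
  proof (rule min)
    have zX: "z \<in> X" using z U by blast
    show sub: "orbit G \<phi> z \<subseteq> U" using z by (rule orbit_sub)
    show "orbit G \<phi> z \<noteq> {}" using orbit_refl[OF zX] by blast
    have "closedin T (\<Union>w\<in>orbit G \<phi> z. {w})"
      by (rule closedin_Union) (use fin sub closed in auto)
    then show "closedin T (orbit G \<phi> z)" by simp
    show "invariant_subset G \<phi> (orbit G \<phi> z)"
      unfolding invariant_subset_def
    proof (intro ballI)
      fix g w assume g: "g \<in> carrier G" and "w \<in> orbit G \<phi> z"
      then obtain h where h: "h \<in> carrier G" "w = \<phi> h z" by (auto simp: orbit_def)
      then have "\<phi> g w = \<phi> (g \<otimes> h) z" using composition_rule[OF zX g h(1)] by simp
      then show "\<phi> g w \<in> orbit G \<phi> z" using G.m_closed[OF g h(1)] by (auto simp: orbit_def)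
    qed
  qed
  have fin: "finite (orbit G \<phi> w)" if "z \<in> U" "w \<in> U" "finite (orbit G \<phi> z)" for z w
    using finite_subset[OF orbit_sub[OF that(2)]] that(3) unfolding orbit_eq[OF that(1,3)] by blast
  have index: "subgroup_index G (stabilizer G \<phi> z) = (if finite (orbit G \<phi> z) then enat (card U) else \<infinity>)"
    if "z \<in> U" for z
    using subgroup_index_stabilizer[OF act subsetD[OF U that]] orbit_eq[OF that] by simp
  show ?thesis
    unfolding index[OF x] index[OF y] using fin[OF x y] fin[OF y x] by argo
qed

theorem lemma4p3:
  fixes \<Gamma> :: "('g, 'b) monoid_scheme"
    and M :: "('h::chilbert_space \<Rightarrow>\<^sub>L 'h) set"
    and \<tau> :: "('h \<Rightarrow>\<^sub>L 'h) \<Rightarrow> complex"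
    and \<alpha> :: "'g \<Rightarrow> ('h \<Rightarrow>\<^sub>L 'h) \<Rightarrow> ('h \<Rightarrow>\<^sub>L 'h)"
    and \<U> :: "('h \<Rightarrow>\<^sub>L 'h) set set"
  assumes "group \<Gamma>" and "countable (carrier \<Gamma>)"
    and "tracial_von_neumann_algebra M \<tau>" and "separable_predual M"
    and "trace_preserving_action \<Gamma> M \<tau> \<alpha>"
    and "URA \<Gamma> M \<tau> \<alpha> \<U>"
  shows "\<forall>N\<in>\<U>. \<forall>N'\<in>\<U>.
    subgroup_index \<Gamma> (stabilizer \<Gamma> (sub_action \<alpha>) N) =
    subgroup_index \<Gamma> (stabilizer \<Gamma> (sub_action \<alpha>) N')"
proof (intro ballI)
  fix N N' assume N: "N \<in> \<U>" and N': "N' \<in> \<U>"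
  interpret tracial M \<tau> using assms by unfold_locales
  let ?\<phi> = "\<lambda>g. restrict (sub_action \<alpha> g) (Pow M)"
  let ?T = "effros_marechal_topology M \<tau>"
  have act: "group_action \<Gamma> (Pow M) ?\<phi>"
    using assms by (intro sub_action_group_action) (simp add: trace_preserving_action_def)
  have U: "\<U> \<subseteq> Sub M" "closedin ?T \<U>" "invariant_subset \<Gamma> (sub_action \<alpha>) \<U>"
    and min: "\<And>V. V \<subseteq> \<U> \<Longrightarrow> V \<noteq> {} \<Longrightarrow> closedin ?T V \<Longrightarrow>
      invariant_subset \<Gamma> (sub_action \<alpha>) V \<Longrightarrow> V = \<U>"
    using assms by (auto simp: URA_def)
  have U_Pow: "\<U> \<subseteq> Pow M" using U(1) by (auto simp: Sub_def)
  have stab: "stabilizer \<Gamma> ?\<phi> L = stabilizer \<Gamma> (sub_action \<alpha>) L" if "L \<in> \<U>" for L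
    using that U_Pow by (auto simp: stabilizer_def)
  have "subgroup_index \<Gamma> (stabilizer \<Gamma> ?\<phi> N) = subgroup_index \<Gamma> (stabilizer \<Gamma> ?\<phi> N')"
  proof (rule minimal_invariant_index_constant[OF act U_Pow _ _ _ N N'])
    show "closedin ?T {L}" if "L \<in> \<U>" for L
      using that U(1) by (intro closedin_effros_marechal_singleton) auto
    show "?\<phi> g L \<in> \<U>" if "g \<in> carrier \<Gamma>" "L \<in> \<U>" for g L
      using that U(3) U_Pow by (auto simp: invariant_subset_def)
    show "V = \<U>" if "V \<subseteq> \<U>" "V \<noteq> {}" "closedin ?T V" "invariant_subset \<Gamma> ?\<phi> V" for V
    proof (rule min)
      show "invariant_subset \<Gamma> (sub_action \<alpha>) V"
        using that U_Pow by (auto simp: invariant_subset_def) (metis PowI Pow_iff restrict_apply' subsetD)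
    qed (use that in auto)
  qed
  then show "subgroup_index \<Gamma> (stabilizer \<Gamma> (sub_action \<alpha>) N) =
      subgroup_index \<Gamma> (stabilizer \<Gamma> (sub_action \<alpha>) N')"
    by (simp add: stab N N')
qed

end
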